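(* If $G$ is a connected, locally path connected topological group and $(\widetilde G,p)$ is a generalized covering group of $G$, then $p:\widetilde G\to G$ is a fibration.
   Context: A continuous map $p:(\widetilde X,\tilde x_0)\to (X,x_0)$ has the unique lifting property if for every connected, locally path connected space $(Y,y_0)$ and every continuous map $f:(Y,y_0)\to (X,x_0)$ with $f_*\pi_1(Y,y_0)\subseteq p_*\pi_1(\widetilde X,\tilde x_0)$ there exists a unique continuous map $\tilde f:(Y,y_0)\to(\widetilde X,\tilde x_0)$ with $p\circ \tilde f=f$. If moreover $\widetilde X$ is connected and locally path connected, then $p$ is called a generalized covering map and $(\widetilde X,p)$ a generalized covering space of $X$. A generalized covering group of a topological group $G$ (with identity $e$) is a pair $(\widetilde G,p)$ consisting of a topological group $\widetilde G$ (with identity $\tilde e$) and a homomorphism $p:(\widetilde G,\tilde e)\to (G,e)$ such that $(\widetilde G,p)$ is a generalized covering space of $G$. A fibration is a (Hurewicz) fibration: a map with the homotopy lifting property with respect to all topological spaces. *)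

theory Defs
  imports "HOL-Analysis.Analysis" "HOL-Algebra.Group"
begin

section \<open>The fundamental group and induced maps\<close>

text \<open>
  Paths are functions on the reals of which only the restriction to the unit interval matters.
  \<open>homotopic_with\<close> relates any two functions that agree on the domain space, so each class below
  contains all such representatives of its loops.
\<close>

definition loops :: "'a topology \<Rightarrow> 'a \<Rightarrow> (real \<Rightarrow> 'a) set" where
  "loops X x = {\<gamma>. pathin X \<gamma> \<and> \<gamma> 0 = x \<and> \<gamma> 1 = x}"

definition loop_homotopy :: "'a topology \<Rightarrow> 'a \<Rightarrow> ((real \<Rightarrow> 'a) \<times> (real \<Rightarrow> 'a)) set" where
  "loop_homotopy X x =
     {(\<gamma>, \<delta>). homotopic_with (\<lambda>\<eta>. \<eta> 0 = x \<and> \<eta> 1 = x) (top_of_set {0..1}) X \<gamma> \<delta>}"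

text \<open>Only the underlying set of the fundamental group is needed, since it is used only in
  inclusions between images of induced homomorphisms.\<close>

definition fundamental_group :: "'a topology \<Rightarrow> 'a \<Rightarrow> (real \<Rightarrow> 'a) set set" where
  "fundamental_group X x = loops X x // loop_homotopy X x"

text \<open>The induced map \<open>f\<^sub>*[\<gamma>] = [f \<circ> \<gamma>]\<close>, for \<open>f\<close> into the pointed space \<open>(X, x)\<close>.\<close>

definition induced_map ::
    "'b topology \<Rightarrow> 'b \<Rightarrow> ('a \<Rightarrow> 'b) \<Rightarrow> (real \<Rightarrow> 'a) set \<Rightarrow> (real \<Rightarrow> 'b) set" where
  "induced_map X x f c = loop_homotopy X x `` ((\<lambda>\<gamma>. f \<circ> \<gamma>) ` c)"


section \<open>Generalized covering maps\<close>

text \<open>Lifts are functions on a type of which only the restriction to the space matters; uniqueness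
  is therefore expressed for functions that are \<open>extensional\<close> on the space.\<close>

definition unique_lifts_from ::
    "'y topology \<Rightarrow> 'y \<Rightarrow> 'e topology \<Rightarrow> 'e \<Rightarrow> 'x topology \<Rightarrow> 'x \<Rightarrow> ('e \<Rightarrow> 'x) \<Rightarrow> bool" where
  "unique_lifts_from Y y E e X x p \<longleftrightarrow>
     (\<forall>f. continuous_map Y X f \<and> f y = x \<and>
          induced_map X x f ` fundamental_group Y y \<subseteq> induced_map X x p ` fundamental_group E e \<longrightarrow>
          (\<exists>!g. g \<in> extensional (topspace Y) \<and> continuous_map Y E g \<and> g y = e \<and>
                (\<forall>z\<in>topspace Y. p (g z) = f z)))"

text \<open>
  A formula cannot quantify over all types, so the test spaces \<open>Y\<close> range over the topologies on
  one type depending on the type of \<open>X\<close>. This is no restriction: theorem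
  \<open>unique_lifts_from_all_spaces\<close> below shows that, for pointed continuous \<open>p\<close>, the property for
  these \<open>Y\<close> implies it for connected, locally path connected spaces over arbitrary types.
\<close>

definition unique_lifting_property ::
    "'e topology \<Rightarrow> 'e \<Rightarrow> 'x topology \<Rightarrow> 'x \<Rightarrow> ('e \<Rightarrow> 'x) \<Rightarrow> bool" where
  "unique_lifting_property E e X x p \<longleftrightarrow>
     (\<forall>(Y :: ((real \<Rightarrow> 'x) \<times> real \<times> real) topology) y.
        connected_space Y \<and> locally_path_connected_space Y \<and> y \<in> topspace Y \<longrightarrow>
        unique_lifts_from Y y E e X x p)"

definition generalized_covering_map ::
    "'e topology \<Rightarrow> 'e \<Rightarrow> 'x topology \<Rightarrow> 'x \<Rightarrow> ('e \<Rightarrow> 'x) \<Rightarrow> bool" where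
  "generalized_covering_map E e X x p \<longleftrightarrow>
     continuous_map E X p \<and> e \<in> topspace E \<and> p e = x \<and>
     unique_lifting_property E e X x p \<and>
     connected_space E \<and> locally_path_connected_space E"


section \<open>Topological groups and generalized covering groups\<close>

locale topological_group = group G for G (structure) +
  fixes T
  assumes topspace_eq_carrier: "topspace T = carrier G"
    and continuous_mult: "continuous_map (prod_topology T T) T (\<lambda>(a, b). a \<otimes> b)"
    and continuous_inv: "continuous_map T T (\<lambda>a. inv a)"

definition generalized_covering_group ::
    "('e, 'm) monoid_scheme \<Rightarrow> 'e topology \<Rightarrow> ('x, 'n) monoid_scheme \<Rightarrow> 'x topology \<Rightarrow>
     ('e \<Rightarrow> 'x) \<Rightarrow> bool" where
  "generalized_covering_group E S G T p \<longleftrightarrow>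
     topological_group E S \<and> p \<in> hom E G \<and>
     generalized_covering_map S \<one>\<^bsub>E\<^esub> T \<one>\<^bsub>G\<^esub> p"


section \<open>Fibrations\<close>

definition homotopy_lifting_property ::
    "'z topology \<Rightarrow> 'e topology \<Rightarrow> 'x topology \<Rightarrow> ('e \<Rightarrow> 'x) \<Rightarrow> bool" where
  "homotopy_lifting_property Z E X p \<longleftrightarrow>
     (\<forall>h f. continuous_map (prod_topology Z (top_of_set {0..1::real})) X h \<and>
            continuous_map Z E f \<and> (\<forall>z\<in>topspace Z. p (f z) = h (z, 0)) \<longrightarrow>
            (\<exists>H. continuous_map (prod_topology Z (top_of_set {0..1})) E H \<and>
                 (\<forall>z\<in>topspace Z. H (z, 0) = f z) \<and>
                 (\<forall>z\<in>topspace Z. \<forall>t\<in>{0..1}. p (H (z, t)) = h (z, t))))"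

text \<open>The test spaces range over all topologies on the type passed as first argument. A theorem
  concluding \<open>fibration TYPE('z) E X p\<close> with \<open>'z\<close> not occurring elsewhere covers all spaces.\<close>

definition fibration ::
    "'z itself \<Rightarrow> 'e topology \<Rightarrow> 'x topology \<Rightarrow> ('e \<Rightarrow> 'x) \<Rightarrow> bool" where
  "fibration _ E X p \<longleftrightarrow>
     continuous_map E X p \<and> (\<forall>Z :: 'z topology. homotopy_lifting_property Z E X p)"


section \<open>Lifting from spaces over arbitrary types\<close>

context notes prod_topology_subtopology_eu [simp del]
begin

lemma lpc_interval: "locally_path_connected_space (top_of_set {0..1::real})"
proof (rule locally_path_connected_space_retraction_map_image)
  show "retraction_map euclideanreal (top_of_set {0..1::real}) (\<lambda>t. max 0 (min 1 t))"
    unfolding retraction_map_def retraction_maps_def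
    by (rule exI [where x = id]) (auto simp: continuous_map_in_subtopology intro!: continuous_intros)
qed (rule locally_path_connected_space_euclideanreal)

lemma induced_map_class:
  assumes f: "continuous_map Y X f" "f y = x" and \<gamma>: "\<gamma> \<in> loops Y y"
  shows "induced_map X x f (loop_homotopy Y y `` {\<gamma>}) = loop_homotopy X x `` {f \<circ> \<gamma>}"
proof -
  have 1: "(f \<circ> \<gamma>, f \<circ> \<delta>) \<in> loop_homotopy X x" if "(\<gamma>, \<delta>) \<in> loop_homotopy Y y" for \<delta>
    using that f homotopic_with_compose_continuous_map_left
      [OF _ f(1), of "\<lambda>\<eta>. \<eta> 0 = y \<and> \<eta> 1 = y" "top_of_set {0..1}" \<gamma> \<delta> "\<lambda>\<eta>. \<eta> 0 = x \<and> \<eta> 1 = x"]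
    by (auto simp: loop_homotopy_def)
  have 2: "(\<gamma>, \<gamma>) \<in> loop_homotopy Y y"
    using \<gamma> by (simp add: loop_homotopy_def loops_def pathin_def)
  have 3: "(f \<circ> \<gamma>, \<zeta>) \<in> loop_homotopy X x"
    if "(f \<circ> \<gamma>, \<xi>) \<in> loop_homotopy X x" "(\<xi>, \<zeta>) \<in> loop_homotopy X x" for \<xi> \<zeta>
    using that unfolding loop_homotopy_def by (auto intro: homotopic_with_trans)
  show ?thesis
  proof (intro equalityI subsetI)
    fix \<zeta> assume "\<zeta> \<in> induced_map X x f (loop_homotopy Y y `` {\<gamma>})"
    then obtain \<delta> where "(\<gamma>, \<delta>) \<in> loop_homotopy Y y" "(f \<circ> \<delta>, \<zeta>) \<in> loop_homotopy X x"
      unfolding induced_map_def by auto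
    with 1 3 show "\<zeta> \<in> loop_homotopy X x `` {f \<circ> \<gamma>}" by blast
  next
    fix \<zeta> assume "\<zeta> \<in> loop_homotopy X x `` {f \<circ> \<gamma>}"
    with 2 show "\<zeta> \<in> induced_map X x f (loop_homotopy Y y `` {\<gamma>})"
      unfolding induced_map_def by auto
  qed
qed

lemma induced_map_subset_iff:
  assumes f: "continuous_map Y X f" "f y = x" and p: "continuous_map E X p" "p e = x"
  shows "induced_map X x f ` fundamental_group Y y \<subseteq> induced_map X x p ` fundamental_group E e
    \<longleftrightarrow> (\<forall>\<gamma>\<in>loops Y y. \<exists>\<epsilon>\<in>loops E e. (f \<circ> \<gamma>, p \<circ> \<epsilon>) \<in> loop_homotopy X x)" (is "?L \<longleftrightarrow> ?R")
proof -
  have fg: "induced_map X x f ` fundamental_group Y y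
      = (\<lambda>\<gamma>. loop_homotopy X x `` {f \<circ> \<gamma>}) ` loops Y y"
    using induced_map_class [OF f] by (auto simp: fundamental_group_def quotient_def image_iff)
  have pg: "induced_map X x p ` fundamental_group E e
      = (\<lambda>\<gamma>. loop_homotopy X x `` {p \<circ> \<gamma>}) ` loops E e"
    using induced_map_class [OF p] by (auto simp: fundamental_group_def quotient_def image_iff)
  have eq: "loop_homotopy X x `` {f \<circ> \<gamma>} = loop_homotopy X x `` {p \<circ> \<epsilon>}
      \<longleftrightarrow> (f \<circ> \<gamma>, p \<circ> \<epsilon>) \<in> loop_homotopy X x" if "\<epsilon> \<in> loops E e" for \<gamma> \<epsilon>
  proof -
    have "(p \<circ> \<epsilon>, p \<circ> \<epsilon>) \<in> loop_homotopy X x"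
      using that p
      by (auto simp: loop_homotopy_def loops_def pathin_def intro: continuous_map_compose)
    moreover have "(\<xi>, \<zeta>) \<in> loop_homotopy X x \<Longrightarrow> (\<zeta>, \<xi>) \<in> loop_homotopy X x" for \<xi> \<zeta>
      by (auto simp: loop_homotopy_def homotopic_with_sym)
    moreover have "(\<xi>, \<zeta>) \<in> loop_homotopy X x"
      if "(\<xi>, \<eta>) \<in> loop_homotopy X x" "(\<eta>, \<zeta>) \<in> loop_homotopy X x" for \<xi> \<eta> \<zeta>
      using that unfolding loop_homotopy_def by (auto intro: homotopic_with_trans)
    ultimately show ?thesis by blast
  qed
  show ?thesis
  proof
    assume L: ?L
    show ?R
    proof
      fix \<gamma> assume "\<gamma> \<in> loops Y y"
      then have "loop_homotopy X x `` {f \<circ> \<gamma>} \<in> (\<lambda>\<gamma>. loop_homotopy X x `` {p \<circ> \<gamma>}) ` loops E e"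
        using L unfolding fg pg by blast
      then obtain \<epsilon> where \<epsilon>: "\<epsilon> \<in> loops E e"
          "loop_homotopy X x `` {f \<circ> \<gamma>} = loop_homotopy X x `` {p \<circ> \<epsilon>}"
        by (rule imageE)
      then show "\<exists>\<epsilon>\<in>loops E e. (f \<circ> \<gamma>, p \<circ> \<epsilon>) \<in> loop_homotopy X x"
        using eq [OF \<epsilon>(1)] by blast
    qed
  next
    assume R: ?R
    show ?L
      unfolding fg pg
    proof (rule image_subsetI)
      fix \<gamma> assume "\<gamma> \<in> loops Y y"
      with R obtain \<epsilon> where \<epsilon>: "\<epsilon> \<in> loops E e" "(f \<circ> \<gamma>, p \<circ> \<epsilon>) \<in> loop_homotopy X x"
        by blast
      then show "loop_homotopy X x `` {f \<circ> \<gamma>} \<in> (\<lambda>\<gamma>. loop_homotopy X x `` {p \<circ> \<gamma>}) ` loops E e"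
        using eq [OF \<epsilon>(1)] by blast
    qed
  qed
qed

lemma trivial_loops:
  assumes k: "continuous_map (prod_topology (top_of_set {0..1::real}) Y) X k"
    and k1: "\<And>q. q \<in> topspace Y \<Longrightarrow> k (1, q) = f q"
    and k0: "\<And>q. q \<in> topspace Y \<Longrightarrow> k (0, q) = x"
    and kb: "\<And>s. s \<in> {0..1} \<Longrightarrow> k (s, y) = x"
    and e: "e \<in> topspace E" "p e = x" and \<gamma>: "\<gamma> \<in> loops Y y"
  shows "\<exists>\<epsilon>\<in>loops E e. (f \<circ> \<gamma>, p \<circ> \<epsilon>) \<in> loop_homotopy X x"
proof
  show "(\<lambda>_. e) \<in> loops E e" using e by (simp add: loops_def)
  have cg: "continuous_map (top_of_set {0..1}) Y \<gamma>" using \<gamma> by (simp add: loops_def pathin_def)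
  then have gt: "\<gamma> t \<in> topspace Y" if "t \<in> {0..1}" for t
    using that by (auto simp: continuous_map_def)
  have c: "continuous_map (prod_topology (top_of_set {0..1::real}) (top_of_set {0..1})) X
      (k \<circ> (\<lambda>z. (fst z, (\<gamma> \<circ> snd) z)))"
    by (intro continuous_map_compose [OF _ k] continuous_map_pairedI continuous_map_fst
        continuous_map_compose [OF continuous_map_snd cg])
  have h: "homotopic_with (\<lambda>\<eta>. \<eta> 0 = x \<and> \<eta> 1 = x) (top_of_set {0..1}) X
     (\<lambda>t. k (0, \<gamma> t)) (\<lambda>t. k (1, \<gamma> t))"
    unfolding homotopic_with_def
    using c \<gamma> kb by (intro exI [where x = "k \<circ> (\<lambda>z. (fst z, (\<gamma> \<circ> snd) z))"])
       (auto simp: loops_def)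
  have "homotopic_with (\<lambda>\<eta>. \<eta> 0 = x \<and> \<eta> 1 = x) (top_of_set {0..1}) X (p \<circ> (\<lambda>_. e)) (f \<circ> \<gamma>)"
  proof -
    have a: "homotopic_with (\<lambda>\<eta>. \<eta> 0 = x \<and> \<eta> 1 = x) (top_of_set {0..1}) X
        (p \<circ> (\<lambda>_. e)) (\<lambda>t. k (0, \<gamma> t))"
      using h e k0 gt homotopic_with_imp_continuous_maps [OF h] homotopic_with_imp_property [OF h]
      by (subst homotopic_with_sym, intro homotopic_with_equal) auto
    have b: "homotopic_with (\<lambda>\<eta>. \<eta> 0 = x \<and> \<eta> 1 = x) (top_of_set {0..1}) X
        (\<lambda>t. k (1, \<gamma> t)) (f \<circ> \<gamma>)"
      using k1 gt homotopic_with_imp_continuous_maps [OF h] homotopic_with_imp_property [OF h]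
      by (intro homotopic_with_equal) auto
    show ?thesis by (rule homotopic_with_trans [OF homotopic_with_trans [OF a h] b])
  qed
  then show "(f \<circ> \<gamma>, p \<circ> (\<lambda>_. e)) \<in> loop_homotopy X x"
    by (simp add: loop_homotopy_def homotopic_with_sym)
qed

lemma unique_lifts_fromD:
  assumes "unique_lifts_from Y y E e X x p" "continuous_map Y X f" "f y = x"
    and p: "continuous_map E X p" "p e = x" and y: "y \<in> topspace Y"
    and incl: "\<And>\<gamma>. \<gamma> \<in> loops Y y \<Longrightarrow> \<exists>\<epsilon>\<in>loops E e. (f \<circ> \<gamma>, p \<circ> \<epsilon>) \<in> loop_homotopy X x"
  shows "\<exists>g. continuous_map Y E g \<and> g y = e \<and> (\<forall>z\<in>topspace Y. p (g z) = f z)"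
    and "\<And>g g'. \<lbrakk>continuous_map Y E g; g y = e; \<And>z. z \<in> topspace Y \<Longrightarrow> p (g z) = f z;
      continuous_map Y E g'; g' y = e; \<And>z. z \<in> topspace Y \<Longrightarrow> p (g' z) = f z; z \<in> topspace Y\<rbrakk>
      \<Longrightarrow> g z = g' z"
proof -
  have ex1: "\<exists>!g. g \<in> extensional (topspace Y) \<and> continuous_map Y E g \<and> g y = e \<and>
                (\<forall>z\<in>topspace Y. p (g z) = f z)"
  proof -
    have "induced_map X x f ` fundamental_group Y y \<subseteq> induced_map X x p ` fundamental_group E e"
      unfolding induced_map_subset_iff [OF assms(2,3) p] using incl by blast
    with assms(1-3) show ?thesis unfolding unique_lifts_from_def by blast
  qed
  then show "\<exists>g. continuous_map Y E g \<and> g y = e \<and> (\<forall>z\<in>topspace Y. p (g z) = f z)" by blast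
  fix g g'
  assume g: "continuous_map Y E g" "g y = e" "\<And>z. z \<in> topspace Y \<Longrightarrow> p (g z) = f z"
    and g': "continuous_map Y E g'" "g' y = e" "\<And>z. z \<in> topspace Y \<Longrightarrow> p (g' z) = f z"
    and z: "z \<in> topspace Y"
  let ?P = "\<lambda>g. g \<in> extensional (topspace Y) \<and> continuous_map Y E g \<and> g y = e \<and>
                (\<forall>z\<in>topspace Y. p (g z) = f z)"
  have "?P (restrict g (topspace Y))"
    using g y by (auto intro: continuous_map_eq)
  moreover have "?P (restrict g' (topspace Y))"
    using g' y by (auto intro: continuous_map_eq)
  ultimately have "restrict g (topspace Y) = restrict g' (topspace Y)"
    using ex1 by blast
  then show "g z = g' z" using z by (metis restrict_apply')
qed

definition path_join :: "(real \<Rightarrow> 'a) \<Rightarrow> (real \<Rightarrow> 'a) \<Rightarrow> real \<Rightarrow> 'a" where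
  "path_join \<gamma> \<delta> t = (if t \<le> 1/2 then \<gamma> (2 * t) else \<delta> (2 * t - 1))"

lemma pathin_reparam:
  assumes "pathin X \<gamma>" "continuous_on {0..1} r" "r \<in> {0..1} \<rightarrow> {0..1}"
  shows "pathin X (\<lambda>t. \<gamma> (r t))"
proof -
  have "continuous_map (top_of_set {0..1}) (top_of_set {0..1}) r"
    using assms by (simp add: continuous_map_in_subtopology image_subset_iff_funcset)
  from continuous_map_compose [OF this] assms(1) show ?thesis
    by (simp add: pathin_def o_def)
qed

lemma pathin_path_join:
  assumes \<gamma>: "pathin X \<gamma>" and \<delta>: "pathin X \<delta>" and eq: "\<gamma> 1 = \<delta> 0"
  shows "pathin X (path_join \<gamma> \<delta>)"
proof -
  have g: "continuous_map (subtopology (top_of_set {0..1}) {t. t \<in> topspace (top_of_set {0..1}) \<and> t \<le> 1/2}) X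
     (\<gamma> \<circ> (\<lambda>t. 2 * t))"
    using \<gamma> unfolding pathin_def
    by (intro continuous_map_compose [where X' = "top_of_set {0..1}"])
      (auto simp: continuous_map_in_subtopology subtopology_subtopology intro!: continuous_intros)
  have d: "continuous_map (subtopology (top_of_set {0..1}) {t. t \<in> topspace (top_of_set {0..1}) \<and> 1/2 \<le> t}) X
     (\<delta> \<circ> (\<lambda>t. 2 * t - 1))"
    using \<delta> unfolding pathin_def
    by (intro continuous_map_compose [where X' = "top_of_set {0..1}"])
      (auto simp: continuous_map_in_subtopology subtopology_subtopology intro!: continuous_intros)
  have "continuous_map (top_of_set {0..1}) X
     (\<lambda>t. if t \<le> 1/2 then (\<gamma> \<circ> (\<lambda>t. 2 * t)) t else (\<delta> \<circ> (\<lambda>t. 2 * t - 1)) t)"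
  proof (rule continuous_map_cases_le [OF _ _ g d])
    fix t :: real
    assume "t = 1/2"
    then have "2 * t = 1" by simp
    then show "(\<gamma> \<circ> (\<lambda>t. 2 * t)) t = (\<delta> \<circ> (\<lambda>t. 2 * t - 1)) t" using eq by simp
  qed (auto intro!: continuous_intros)
  moreover have "(\<lambda>t. if t \<le> 1/2 then (\<gamma> \<circ> (\<lambda>t. 2 * t)) t else (\<delta> \<circ> (\<lambda>t. 2 * t - 1)) t) = path_join \<gamma> \<delta>"
    by (simp add: path_join_def fun_eq_iff)
  ultimately show ?thesis by (simp add: pathin_def)
qed

context
  fixes E :: "'e topology" and e and X :: "'x topology" and x and p
  assumes ulp: "unique_lifting_property E e X x p"
    and p: "continuous_map E X p" "p e = x" and e: "e \<in> topspace E"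
begin

lemma square_lift:
  assumes h: "continuous_map (prod_topology (top_of_set {0..1::real}) (top_of_set {0..1::real})) X h"
    and h0: "h (0, 0) = x"
  shows "\<exists>g. continuous_map (prod_topology (top_of_set {0..1}) (top_of_set {0..1})) E g \<and>
     g (0, 0) = e \<and> (\<forall>z\<in>{0..1}\<times>{0..1}. p (g z) = h z)" (is ?thesis1)
  and "\<And>g g'. \<lbrakk>continuous_map (prod_topology (top_of_set {0..1}) (top_of_set {0..1})) E g; g (0, 0) = e;
     \<And>z. z \<in> {0..1}\<times>{0..1} \<Longrightarrow> p (g z) = h z;
     continuous_map (prod_topology (top_of_set {0..1}) (top_of_set {0..1})) E g'; g' (0, 0) = e;
     \<And>z. z \<in> {0..1}\<times>{0..1} \<Longrightarrow> p (g' z) = h z; z \<in> {0..1}\<times>{0..1}\<rbrakk> \<Longrightarrow> g z = g' z"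
proof -
  define Q where "Q = prod_topology (top_of_set {0..1::real}) (top_of_set {0..1::real})"
  define u :: "real \<Rightarrow> 'x" where "u = undefined"
  define Y where "Y = prod_topology (discrete_topology {u}) Q"
  have Q: "path_connected_space Q" "locally_path_connected_space Q"
    unfolding Q_def
    by (auto simp: path_connected_space_prod_topology locally_path_connected_space_prod_topology
        lpc_interval)
  have tQ: "topspace Q = {0..1} \<times> {0..1}" by (simp add: Q_def)
  have "path_connected_space (discrete_topology {u})"
    by (auto simp: path_connected_space_def intro: exI [where x = "\<lambda>_. u"])
  with Q have Y: "connected_space Y" "locally_path_connected_space Y"
    unfolding Y_def
    by (auto simp: path_connected_space_prod_topology locally_path_connected_space_prod_topology
        locally_path_connected_space_discrete_topology intro!: path_connected_imp_connected_space)
  have ty: "(u, 0, 0) \<in> topspace Y" by (simp add: Y_def tQ)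
  have snd: "continuous_map Y Q snd" by (simp add: Y_def continuous_map_snd)
  have emb: "continuous_map Q Y (\<lambda>z. (u, z))"
    unfolding Y_def by (intro continuous_map_pairedI) auto
  have U: "unique_lifts_from Y (u, 0, 0) E e X x p"
    using ulp Y ty unfolding unique_lifting_property_def by blast
  have hc: "continuous_map Y X (h \<circ> snd)"
    using h snd by (simp add: Q_def continuous_map_compose)
  let ?P = "prod_topology (top_of_set {0..1::real}) (prod_topology (discrete_topology {u})
      (prod_topology (top_of_set {0..1::real}) (top_of_set {0..1::real})))"
  have s1: "continuous_map ?P (prod_topology (top_of_set {0..1::real}) (top_of_set {0..1::real})) (snd \<circ> snd)"
    by (rule continuous_map_compose [OF continuous_map_snd continuous_map_snd])
  have c1: "continuous_map ?P euclideanreal fst"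
    using continuous_map_fst [of "top_of_set {0..1::real}" "prod_topology (discrete_topology {u})
      (prod_topology (top_of_set {0..1::real}) (top_of_set {0..1::real}))"]
    by (simp add: continuous_map_in_subtopology)
  have c2: "continuous_map ?P euclideanreal (\<lambda>w. fst (snd (snd w)))"
    using continuous_map_compose [OF s1 continuous_map_fst]
    by (simp add: continuous_map_in_subtopology o_def)
  have c3: "continuous_map ?P euclideanreal (\<lambda>w. snd (snd (snd w)))"
    using continuous_map_compose [OF s1 continuous_map_snd]
    by (simp add: continuous_map_in_subtopology o_def)
  have k: "continuous_map (prod_topology (top_of_set {0..1::real}) Y) X
      (h \<circ> (\<lambda>w. (fst w * fst (snd (snd w)), fst w * snd (snd (snd w)))))"
  proof (rule continuous_map_compose)
    show "continuous_map (prod_topology (top_of_set {0..1::real}) Y)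
      (prod_topology (top_of_set {0..1::real}) (top_of_set {0..1::real}))
      (\<lambda>w. (fst w * fst (snd (snd w)), fst w * snd (snd (snd w))))"
      unfolding Y_def Q_def
      using c1 c2 c3 by (intro continuous_map_pairedI)
        (auto simp: continuous_map_in_subtopology mult_le_one intro!: continuous_map_real_mult)
  qed (rule h)
  have incl: "\<exists>\<epsilon>\<in>loops E e. (h \<circ> snd \<circ> \<gamma>, p \<circ> \<epsilon>) \<in> loop_homotopy X x"
    if "\<gamma> \<in> loops Y (u, 0, 0)" for \<gamma>
    by (rule trivial_loops [where f = "h \<circ> snd"
          and k = "h \<circ> (\<lambda>w. (fst w * fst (snd (snd w)), fst w * snd (snd (snd w))))" and p = p and e = e and x = x,
          OF k _ _ _ e p(2) that])
      (use h0 in \<open>auto simp: Y_def tQ\<close>)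
  have hu: "(h \<circ> snd) (u, 0, 0) = x" using h0 by simp
  note D = unique_lifts_fromD [OF U hc hu p ty incl]
  show ?thesis1
  proof -
    obtain g where g: "continuous_map Y E g" "g (u, 0, 0) = e" "\<forall>z\<in>topspace Y. p (g z) = (h \<circ> snd) z"
      using D(1) h0 by auto
    have "continuous_map Q E (g \<circ> (\<lambda>z. (u, z)))"
      by (rule continuous_map_compose [OF emb g(1)])
    then show ?thesis
      using g by (intro exI [where x = "g \<circ> (\<lambda>z. (u, z))"]) (auto simp: Q_def Y_def)
  qed
  fix g g' z
  assume g: "continuous_map (prod_topology (top_of_set {0..1}) (top_of_set {0..1})) E g" "g (0, 0) = e"
     "\<And>z. z \<in> {0..1}\<times>{0..1} \<Longrightarrow> p (g z) = h z"
    and g': "continuous_map (prod_topology (top_of_set {0..1}) (top_of_set {0..1})) E g'" "g' (0, 0) = e"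
     "\<And>z. z \<in> {0..1}\<times>{0..1} \<Longrightarrow> p (g' z) = h z" and z: "z \<in> {0..1::real}\<times>{0..1::real}"
  have "(g \<circ> snd) (u, z) = (g' \<circ> snd) (u, z)"
  proof (rule D(2))
    show "continuous_map Y E (g \<circ> snd)" "continuous_map Y E (g' \<circ> snd)"
      using g(1) g'(1) snd by (auto simp: Q_def intro: continuous_map_compose)
  qed (use g g' z h0 in \<open>auto simp: Y_def Q_def\<close>)
  then show "g z = g' z" by simp
qed

lemma path_lift:
  assumes a: "pathin X \<alpha>" "\<alpha> 0 = x"
  shows "\<exists>g. pathin E g \<and> g 0 = e \<and> (\<forall>t\<in>{0..1}. p (g t) = \<alpha> t)"
proof -
  have c: "continuous_map (prod_topology (top_of_set {0..1::real}) (top_of_set {0..1::real})) X (\<alpha> \<circ> fst)"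
    by (rule continuous_map_compose [OF continuous_map_fst a(1) [unfolded pathin_def]])
  obtain g where g: "continuous_map (prod_topology (top_of_set {0..1::real}) (top_of_set {0..1::real})) E g"
     "g (0, 0) = e" "\<forall>z\<in>{0..1}\<times>{0..1}. p (g z) = (\<alpha> \<circ> fst) z"
    using square_lift(1) [OF c] a by auto
  have "continuous_map (top_of_set {0..1::real}) (prod_topology (top_of_set {0..1::real}) (top_of_set {0..1::real})) (\<lambda>t. (t, 0))"
    by (intro continuous_map_pairedI) auto
  from continuous_map_compose [OF this g(1)] g show ?thesis
    by (intro exI [where x = "\<lambda>t. g (t, 0)"]) (auto simp: pathin_def o_def)
qed

lemma path_lift_unique:
  assumes g: "pathin E g" "g 0 = e" and g': "pathin E g'" "g' 0 = e"
    and eq: "\<And>t. t \<in> {0..1} \<Longrightarrow> p (g t) = p (g' t)" and t: "t \<in> {0..1}"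
  shows "g t = g' t"
proof -
  have c: "continuous_map (prod_topology (top_of_set {0..1::real}) (top_of_set {0..1::real})) E (g \<circ> fst)"
     "continuous_map (prod_topology (top_of_set {0..1::real}) (top_of_set {0..1::real})) E (g' \<circ> fst)"
    by (rule continuous_map_compose [OF continuous_map_fst g(1) [unfolded pathin_def]],
        rule continuous_map_compose [OF continuous_map_fst g'(1) [unfolded pathin_def]])
  have hX: "continuous_map (prod_topology (top_of_set {0..1::real}) (top_of_set {0..1::real})) X (p \<circ> (g \<circ> fst))"
    by (rule continuous_map_compose [OF c(1) p(1)])
  have hx: "(p \<circ> (g \<circ> fst)) (0, 0) = x" using g(2) p(2) by simp
  have "(g \<circ> fst) (t, 0::real) = (g' \<circ> fst) (t, 0::real)"
  proof (rule square_lift(2) [OF hX hx c(1) _ _ c(2)])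
    show "p ((g' \<circ> fst) z) = (p \<circ> (g \<circ> fst)) z" if "z \<in> {0..1} \<times> {0..1::real}" for z
      using that eq [of "fst z"] by auto
    show "(t, 0::real) \<in> {0..1} \<times> {0..1}" using t by simp
  qed (simp_all add: g(2) g'(2))
  then show ?thesis by simp
qed

lemma lift_of_loop:
  assumes hom: "(\<gamma>, p \<circ> \<epsilon>) \<in> loop_homotopy X x" and \<epsilon>: "\<epsilon> \<in> loops E e"
    and g: "pathin E g" "g 0 = e" "\<And>t. t \<in> {0..1} \<Longrightarrow> p (g t) = \<gamma> t"
  shows "g 1 = e"
proof -
  obtain h where h: "continuous_map (prod_topology (top_of_set {0..1::real}) (top_of_set {0..1})) X h"
     "\<And>t. h (0, t) = \<gamma> t" "\<And>t. h (1, t) = p (\<epsilon> t)" "\<And>s. s \<in> {0..1} \<Longrightarrow> h (s, 0) = x"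
     "\<And>s. s \<in> {0..1} \<Longrightarrow> h (s, 1) = x"
    using hom by (auto simp: loop_homotopy_def homotopic_with_def)
  obtain H where H: "continuous_map (prod_topology (top_of_set {0..1::real}) (top_of_set {0..1::real})) E H"
     "H (0, 0) = e" "\<And>z. z\<in>{0..1}\<times>{0..1} \<Longrightarrow> p (H z) = h z"
    using square_lift(1) [OF h(1)] h(4) by auto
  have row: "pathin E (\<lambda>t. H (s, t))" if "s \<in> {0..1}" for s
  proof -
    have "continuous_map (top_of_set {0..1::real}) (prod_topology (top_of_set {0..1::real}) (top_of_set {0..1::real})) (\<lambda>t. (s, t))"
      using that by (intro continuous_map_pairedI) auto
    from continuous_map_compose [OF this H(1)] show ?thesis by (simp add: pathin_def o_def)
  qed
  have col: "pathin E (\<lambda>s. H (s, t))" if "t \<in> {0..1}" for t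
  proof -
    have "continuous_map (top_of_set {0..1::real}) (prod_topology (top_of_set {0..1::real}) (top_of_set {0..1::real})) (\<lambda>s. (s, t))"
      using that by (intro continuous_map_pairedI) auto
    from continuous_map_compose [OF this H(1)] show ?thesis by (simp add: pathin_def o_def)
  qed
  have 1: "H (s, 0) = e" if "s \<in> {0..1}" for s
    by (rule path_lift_unique [of "\<lambda>s. H (s, 0)" "\<lambda>_. e" s]) (use col H h e p that in auto)
  have 2: "H (1, t) = \<epsilon> t" if "t \<in> {0..1}" for t
    by (rule path_lift_unique [of "\<lambda>t. H (1, t)" \<epsilon> t]) (use row 1 \<epsilon> H h e p that in \<open>auto simp: loops_def\<close>)
  have 3: "H (0, t) = g t" if "t \<in> {0..1}" for t
    by (rule path_lift_unique [of "\<lambda>t. H (0, t)" g t]) (use row 1 g H h e p that in \<open>auto simp: loops_def\<close>)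
  have "H (1, 1) = e" using 2 \<epsilon> by (simp add: loops_def)
  have "(\<lambda>s. H (1 - s, 1)) 1 = (\<lambda>_. e) (1::real)"
  proof (rule path_lift_unique [of "\<lambda>s. H (1 - s, 1)" "\<lambda>_. e" 1])
    show "pathin E (\<lambda>s. H (1 - s, 1))"
      by (rule pathin_reparam [where \<gamma> = "\<lambda>s. H (s, 1)"])
       (use col in \<open>auto intro!: continuous_intros\<close>)
  qed (use e p h H \<open>H (1, 1) = e\<close> in auto)
  then show ?thesis using 3 by simp
qed

lemma lifts_same_end:
  fixes Y :: "'y topology"
  assumes f: "continuous_map Y X f" "f y = x"
    and incl: "\<And>\<gamma>. \<gamma> \<in> loops Y y \<Longrightarrow> \<exists>\<epsilon>\<in>loops E e. (f \<circ> \<gamma>, p \<circ> \<epsilon>) \<in> loop_homotopy X x"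
    and \<gamma>: "pathin Y \<gamma>" "\<gamma> 0 = y" and \<delta>: "pathin Y \<delta>" "\<delta> 0 = y" and eq: "\<gamma> 1 = \<delta> 1"
    and g: "pathin E g" "g 0 = e" "\<And>t. t \<in> {0..1} \<Longrightarrow> p (g t) = f (\<gamma> t)"
    and d: "pathin E d" "d 0 = e" "\<And>t. t \<in> {0..1} \<Longrightarrow> p (d t) = f (\<delta> t)"
  shows "g 1 = d 1"
proof -
  have rev: "pathin Y (\<lambda>t. \<delta> (1 - t))"
    by (rule pathin_reparam [OF \<delta>(1)]) (auto intro!: continuous_intros)
  define l where "l = path_join \<gamma> (\<lambda>t. \<delta> (1 - t))"
  have lp: "pathin Y l" unfolding l_def by (rule pathin_path_join) (use \<gamma> rev eq in auto)
  have l: "l \<in> loops Y y" using lp \<gamma> \<delta> by (auto simp: loops_def l_def path_join_def)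
  obtain \<epsilon> where \<epsilon>: "\<epsilon> \<in> loops E e" "(f \<circ> l, p \<circ> \<epsilon>) \<in> loop_homotopy X x"
    using incl [OF l] by blast
  have "pathin X (f \<circ> l)" by (rule pathin_compose [OF lp f(1)])
  moreover have "(f \<circ> l) 0 = x" using \<gamma> f by (simp add: l_def path_join_def)
  ultimately obtain L where L: "pathin E L" "L 0 = e" "\<And>t. t \<in> {0..1} \<Longrightarrow> p (L t) = (f \<circ> l) t"
    using path_lift [of "f \<circ> l"] by auto
  have L1: "L 1 = e" using lift_of_loop [OF \<epsilon>(2,1) L] .
  have "(\<lambda>t. L (t / 2)) 1 = g 1"
  proof (rule path_lift_unique [of "\<lambda>t. L (t / 2)" g 1])
    show "pathin E (\<lambda>t. L (t / 2))"
      by (rule pathin_reparam [OF L(1)]) (auto intro!: continuous_intros)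
  qed (use L g in \<open>auto simp: l_def path_join_def\<close>)
  moreover have "(\<lambda>t. L (1 - t / 2)) 1 = d 1"
  proof (rule path_lift_unique [of "\<lambda>t. L (1 - t / 2)" d 1])
    show "pathin E (\<lambda>t. L (1 - t / 2))"
      by (rule pathin_reparam [OF L(1)]) (auto intro!: continuous_intros)
    show "p (L (1 - t / 2)) = p (d t)" if "t \<in> {0..1}" for t
      using that L(3) [of "1 - t/2"] d(3) [of t] eq by (auto simp: l_def path_join_def)
  qed (use L1 d in auto)
  ultimately show ?thesis by simp
qed

end

text \<open>
  Given a path \<open>\<sigma>\<close> in \<open>X\<close>, the hedgehog has one spike for each path \<open>\<alpha>\<close> that agrees with \<open>\<sigma>\<close> on
  \<open>[0, 1/2]\<close>, all spikes being glued along that common stem. A neighbourhood of the end of the stem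
  contains the whole spike of every \<open>\<alpha>\<close> that stays close to \<open>\<sigma> (1/2)\<close> on \<open>[1/2, 1]\<close>. Hence the
  evaluation map into \<open>X\<close> is continuous, and so is its lift only if the lifts of small paths at
  \<open>\<sigma> (1/2)\<close> are small; this gives continuity of lifts from arbitrary locally path connected spaces.
\<close>

context
  fixes X :: "'x topology" and \<sigma> :: "real \<Rightarrow> 'x"
  assumes \<sigma>: "pathin X \<sigma>"
begin

definition hedgehog_spikes :: "(real \<Rightarrow> 'x) set" where
  "hedgehog_spikes = {\<alpha>. pathin X \<alpha> \<and> (\<forall>t\<in>{0..1/2}. \<alpha> t = \<sigma> t)}"

definition hedgehog_pt :: "(real \<Rightarrow> 'x) \<Rightarrow> real \<Rightarrow> (real \<Rightarrow> 'x) \<times> real \<times> real" where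
  "hedgehog_pt \<alpha> t = (if t \<le> 1/2 then \<sigma> else \<alpha>, t, 0)"

definition hedgehog_set :: "((real \<Rightarrow> 'x) \<times> real \<times> real) set" where
  "hedgehog_set = {hedgehog_pt \<alpha> t |\<alpha> t. \<alpha> \<in> hedgehog_spikes \<and> t \<in> {0..1}}"

definition hedgehog_open :: "((real \<Rightarrow> 'x) \<times> real \<times> real) set \<Rightarrow> bool" where
  "hedgehog_open S \<longleftrightarrow> S \<subseteq> hedgehog_set \<and>
     (\<forall>\<alpha>\<in>hedgehog_spikes. openin (top_of_set {0..1}) {t\<in>{0..1}. hedgehog_pt \<alpha> t \<in> S}) \<and>
     (hedgehog_pt \<sigma> (1/2) \<in> S \<longrightarrow>
       (\<exists>W. openin X W \<and> \<sigma> (1/2) \<in> W \<and>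
         (\<forall>\<alpha>\<in>hedgehog_spikes. \<alpha> ` {1/2..1} \<subseteq> W \<longrightarrow> (\<forall>t\<in>{1/2..1}. hedgehog_pt \<alpha> t \<in> S))))"

definition hedgehog :: "((real \<Rightarrow> 'x) \<times> real \<times> real) topology" where
  "hedgehog = topology hedgehog_open"

lemma \<sigma>_spike: "\<sigma> \<in> hedgehog_spikes" using \<sigma> by (simp add: hedgehog_spikes_def)

lemma openin_hedgehog: "openin hedgehog = hedgehog_open"
  unfolding hedgehog_def
proof (rule topology_inverse')
  show "istopology hedgehog_open"
    unfolding istopology_def
  proof (intro conjI allI impI)
    fix S T assume S: "hedgehog_open S" and T: "hedgehog_open T"
    have 1: "{t\<in>{0..1}. hedgehog_pt \<alpha> t \<in> S \<inter> T} = {t\<in>{0..1}. hedgehog_pt \<alpha> t \<in> S} \<inter> {t\<in>{0..1}. hedgehog_pt \<alpha> t \<in> T}" for \<alpha>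
      by auto
    show "hedgehog_open (S \<inter> T)"
      unfolding hedgehog_open_def
    proof (intro conjI ballI impI)
      show "S \<inter> T \<subseteq> hedgehog_set" using S by (auto simp: hedgehog_open_def)
      show "openin (top_of_set {0..1}) {t\<in>{0..1}. hedgehog_pt \<alpha> t \<in> S \<inter> T}" if "\<alpha> \<in> hedgehog_spikes" for \<alpha>
        unfolding 1 using S T that by (intro openin_Int) (auto simp: hedgehog_open_def)
      assume c: "hedgehog_pt \<sigma> (1/2) \<in> S \<inter> T"
      obtain W1 where W1: "openin X W1" "\<sigma> (1/2) \<in> W1"
          "\<forall>\<alpha>\<in>hedgehog_spikes. \<alpha> ` {1/2..1} \<subseteq> W1 \<longrightarrow> (\<forall>t\<in>{1/2..1}. hedgehog_pt \<alpha> t \<in> S)"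
        using S c unfolding hedgehog_open_def by blast
      obtain W2 where W2: "openin X W2" "\<sigma> (1/2) \<in> W2"
          "\<forall>\<alpha>\<in>hedgehog_spikes. \<alpha> ` {1/2..1} \<subseteq> W2 \<longrightarrow> (\<forall>t\<in>{1/2..1}. hedgehog_pt \<alpha> t \<in> T)"
        using T c unfolding hedgehog_open_def by blast
      show "\<exists>W. openin X W \<and> \<sigma> (1/2) \<in> W \<and>
         (\<forall>\<alpha>\<in>hedgehog_spikes. \<alpha> ` {1/2..1} \<subseteq> W \<longrightarrow> (\<forall>t\<in>{1/2..1}. hedgehog_pt \<alpha> t \<in> S \<inter> T))"
        using W1 W2 by (intro exI [where x = "W1 \<inter> W2"]) (simp add: openin_Int)
    qed
  next
    fix \<K> assume K: "\<forall>S\<in>\<K>. hedgehog_open S"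
    have 1: "{t\<in>{0..1}. hedgehog_pt \<alpha> t \<in> \<Union>\<K>} = (\<Union>S\<in>\<K>. {t\<in>{0..1}. hedgehog_pt \<alpha> t \<in> S})" for \<alpha>
      by auto
    show "hedgehog_open (\<Union>\<K>)"
      unfolding hedgehog_open_def
    proof (intro conjI ballI impI)
      show "\<Union>\<K> \<subseteq> hedgehog_set" using K by (auto simp: hedgehog_open_def)
      show "openin (top_of_set {0..1}) {t\<in>{0..1}. hedgehog_pt \<alpha> t \<in> \<Union>\<K>}" if "\<alpha> \<in> hedgehog_spikes" for \<alpha>
        unfolding 1 using K that by (intro openin_Union) (auto simp: hedgehog_open_def)
      assume "hedgehog_pt \<sigma> (1/2) \<in> \<Union>\<K>"
      then obtain S where S: "S \<in> \<K>" "hedgehog_pt \<sigma> (1/2) \<in> S" by blast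
      then have "hedgehog_open S" using K by blast
      then obtain W where W: "openin X W" "\<sigma> (1/2) \<in> W"
          "\<forall>\<alpha>\<in>hedgehog_spikes. \<alpha> ` {1/2..1} \<subseteq> W \<longrightarrow> (\<forall>t\<in>{1/2..1}. hedgehog_pt \<alpha> t \<in> S)"
        using S(2) unfolding hedgehog_open_def by blast
      then show "\<exists>W. openin X W \<and> \<sigma> (1/2) \<in> W \<and>
         (\<forall>\<alpha>\<in>hedgehog_spikes. \<alpha> ` {1/2..1} \<subseteq> W \<longrightarrow> (\<forall>t\<in>{1/2..1}. hedgehog_pt \<alpha> t \<in> \<Union>\<K>))"
        using S(1) by (intro exI [where x = W]) auto
    qed
  qed
qed

lemma pt_hset: "\<alpha> \<in> hedgehog_spikes \<Longrightarrow> t \<in> {0..1} \<Longrightarrow> hedgehog_pt \<alpha> t \<in> hedgehog_set"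
  by (auto simp: hedgehog_set_def)

lemma pt_stem: "t \<le> 1/2 \<Longrightarrow> hedgehog_pt \<alpha> t = hedgehog_pt \<beta> t"
  by (simp add: hedgehog_pt_def)

lemma spike_stem: "\<alpha> \<in> hedgehog_spikes \<Longrightarrow> 0 \<le> t \<Longrightarrow> t \<le> 1/2 \<Longrightarrow> \<alpha> t = \<sigma> t"
  by (simp add: hedgehog_spikes_def)

lemma spike_path: "\<alpha> \<in> hedgehog_spikes \<Longrightarrow> pathin X \<alpha>"
  by (simp add: hedgehog_spikes_def)

lemma topspace_hedgehog: "topspace hedgehog = hedgehog_set"
proof -
  have eq: "{t\<in>{0..1}. hedgehog_pt \<alpha> t \<in> hedgehog_set} = {0..1}" if "\<alpha> \<in> hedgehog_spikes" for \<alpha>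
    using pt_hset [OF that] by auto
  have "hedgehog_open hedgehog_set"
    unfolding hedgehog_open_def
  proof (intro conjI ballI impI)
    show "openin (top_of_set {0..1}) {t\<in>{0..1}. hedgehog_pt \<alpha> t \<in> hedgehog_set}" if "\<alpha> \<in> hedgehog_spikes" for \<alpha>
      using eq [OF that] openin_topspace [of "top_of_set {0..1::real}"] by simp
    have "\<sigma> (1/2) \<in> topspace X"
      using path_image_subset_topspace [OF \<sigma>] by (rule funcset_mem) simp
    then show "\<exists>W. openin X W \<and> \<sigma> (1/2) \<in> W \<and>
         (\<forall>\<alpha>\<in>hedgehog_spikes. \<alpha> ` {1/2..1} \<subseteq> W \<longrightarrow> (\<forall>t\<in>{1/2..1}. hedgehog_pt \<alpha> t \<in> hedgehog_set))"
      by (intro exI [where x = "topspace X"]) (auto intro: pt_hset)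
  qed simp
  then show ?thesis
    using openin_subset [of hedgehog hedgehog_set] openin_topspace [of hedgehog]
    unfolding openin_hedgehog by (simp add: hedgehog_open_def subset_antisym)
qed

lemma hedgehogE:
  assumes "q \<in> topspace hedgehog"
  obtains \<alpha> t where "q = hedgehog_pt \<alpha> t" "\<alpha> \<in> hedgehog_spikes" "0 \<le> t" "t \<le> 1"
  using assms unfolding topspace_hedgehog hedgehog_set_def by auto

lemma pathin_pt: "\<alpha> \<in> hedgehog_spikes \<Longrightarrow> pathin hedgehog (hedgehog_pt \<alpha>)"
  unfolding pathin_def continuous_map
  by (intro conjI allI impI image_subsetI) (simp_all add: topspace_hedgehog openin_hedgehog hedgehog_open_def pt_hset)

definition hedgehog_eval :: "(real \<Rightarrow> 'x) \<times> real \<times> real \<Rightarrow> 'x" where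
  "hedgehog_eval q = fst q (fst (snd q))"

lemma ev_pt: "\<alpha> \<in> hedgehog_spikes \<Longrightarrow> 0 \<le> t \<Longrightarrow> hedgehog_eval (hedgehog_pt \<alpha> t) = \<alpha> t"
  by (auto simp: hedgehog_eval_def hedgehog_pt_def spike_stem)

lemma spike_openin:
  assumes "\<alpha> \<in> hedgehog_spikes" "openin X V"
  shows "openin (top_of_set {0..1}) {t\<in>{0..1}. \<alpha> t \<in> V}"
  using spike_path [OF assms(1)] assms(2) unfolding pathin_def continuous_map by simp

lemma continuous_ev: "continuous_map hedgehog X hedgehog_eval"
  unfolding continuous_map
proof (intro conjI allI impI)
  show "hedgehog_eval ` topspace hedgehog \<subseteq> topspace X"
  proof (rule image_subsetI)
    fix q assume "q \<in> topspace hedgehog"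
    then obtain \<alpha> t where "q = hedgehog_pt \<alpha> t" "\<alpha> \<in> hedgehog_spikes" "t \<in> {0..1}"
      by (auto simp: topspace_hedgehog hedgehog_set_def)
    then show "hedgehog_eval q \<in> topspace X"
      using funcset_mem [OF path_image_subset_topspace [OF spike_path]] by (simp add: ev_pt)
  qed
  fix V assume V: "openin X V"
  have eq: "{t\<in>{0..1}. hedgehog_pt \<alpha> t \<in> {q \<in> topspace hedgehog. hedgehog_eval q \<in> V}} = {t\<in>{0..1}. \<alpha> t \<in> V}"
    if "\<alpha> \<in> hedgehog_spikes" for \<alpha>
    using that pt_hset by (auto simp: topspace_hedgehog ev_pt)
  show "openin hedgehog {q \<in> topspace hedgehog. hedgehog_eval q \<in> V}"
    unfolding openin_hedgehog hedgehog_open_def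
  proof (intro conjI ballI impI)
    show "openin (top_of_set {0..1}) {t\<in>{0..1}. hedgehog_pt \<alpha> t \<in> {q \<in> topspace hedgehog. hedgehog_eval q \<in> V}}"
      if "\<alpha> \<in> hedgehog_spikes" for \<alpha>
      unfolding eq [OF that] by (rule spike_openin [OF that V])
    assume "hedgehog_pt \<sigma> (1/2) \<in> {q \<in> topspace hedgehog. hedgehog_eval q \<in> V}"
    then have "\<sigma> (1/2) \<in> V" by (simp add: ev_pt \<sigma>_spike)
    then show "\<exists>W. openin X W \<and> \<sigma> (1/2) \<in> W \<and> (\<forall>\<alpha>\<in>hedgehog_spikes. \<alpha> ` {1/2..1} \<subseteq> W \<longrightarrow>
        (\<forall>t\<in>{1/2..1}. hedgehog_pt \<alpha> t \<in> {q \<in> topspace hedgehog. hedgehog_eval q \<in> V}))"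
      using V by (intro exI [where x = V]) (auto simp: ev_pt topspace_hedgehog pt_hset)
  qed (auto simp: topspace_hedgehog)
qed

lemma segment_component:
  assumes \<alpha>: "\<alpha> \<in> hedgehog_spikes" and ab: "a \<in> {0..1}" "b \<in> {0..1}"
    and U: "\<And>t. t \<in> closed_segment a b \<Longrightarrow> hedgehog_pt \<alpha> t \<in> U"
  shows "path_component_of (subtopology hedgehog U) (hedgehog_pt \<alpha> a) (hedgehog_pt \<alpha> b)"
  unfolding path_component_of_def
proof (intro exI conjI)
  have seg: "(1 - s) * a + s * b \<in> closed_segment a b" if "s \<in> {0..1}" for s
    using that by (auto simp: closed_segment_def)
  have sub: "closed_segment a b \<subseteq> {0..1}"
    using ab by (intro closed_segment_subset) auto
  show "pathin (subtopology hedgehog U) (\<lambda>s. hedgehog_pt \<alpha> ((1 - s) * a + s * b))"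
    unfolding pathin_subtopology
  proof (intro conjI ballI)
    show "pathin hedgehog (\<lambda>s. hedgehog_pt \<alpha> ((1 - s) * a + s * b))"
      by (rule pathin_reparam [OF pathin_pt [OF \<alpha>]])
        (use seg sub in \<open>auto intro!: continuous_intros\<close>)
  qed (use seg U in auto)
qed auto

lemma connected_hedgehog: "connected_space hedgehog"
proof (rule path_connected_imp_connected_space)
  have 1: "path_component_of hedgehog (hedgehog_pt \<sigma> 0) q" if q': "q \<in> topspace hedgehog" for q
  proof -
    obtain \<alpha> t where q: "q = hedgehog_pt \<alpha> t" "\<alpha> \<in> hedgehog_spikes" "0 \<le> t" "t \<le> 1"
      using hedgehogE [OF q'] .
    have "path_component_of (subtopology hedgehog UNIV) (hedgehog_pt \<alpha> 0) (hedgehog_pt \<alpha> t)"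
      by (rule segment_component) (use q in auto)
    then show ?thesis using q pt_stem [of 0 \<alpha> \<sigma>] by simp
  qed
  show "path_connected_space hedgehog"
    unfolding path_connected_space_iff_path_component
    using 1 by (meson path_component_of_sym path_component_of_trans)
qed

lemma lpc_hedgehog: "locally_path_connected_space hedgehog"
  unfolding locally_path_connected_space_eq_open_path_component_of
proof (intro allI impI, elim conjE)
  fix U q assume U: "openin hedgehog U" and q: "q \<in> U"
  let ?C = "Collect (path_component_of (subtopology hedgehog U) q)"
  have CU: "?C \<subseteq> U"
    using path_component_in_topspace by fastforce
  have step: "hedgehog_pt \<alpha> b \<in> ?C" if "\<alpha> \<in> hedgehog_spikes" "a \<in> {0..1}" "b \<in> {0..1}" "hedgehog_pt \<alpha> a \<in> ?C"
      "\<And>t. t \<in> closed_segment a b \<Longrightarrow> hedgehog_pt \<alpha> t \<in> U" for \<alpha> a b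
    using segment_component [OF that(1-3,5)] that(4) path_component_of_trans by fastforce
  have Uo: "hedgehog_open U" using U by (simp add: openin_hedgehog)
  show "openin hedgehog ?C"
    unfolding openin_hedgehog hedgehog_open_def
  proof (intro conjI ballI impI)
    show "?C \<subseteq> hedgehog_set" using CU Uo by (auto simp: hedgehog_open_def)
    show "openin (top_of_set {0..1}) {t\<in>{0..1}. hedgehog_pt \<alpha> t \<in> ?C}" if \<alpha>: "\<alpha> \<in> hedgehog_spikes" for \<alpha>
      unfolding openin_euclidean_subtopology_iff
    proof (intro conjI ballI)
      fix t assume t: "t \<in> {t\<in>{0..1}. hedgehog_pt \<alpha> t \<in> ?C}"
      have "openin (top_of_set {0..1}) {t\<in>{0..1}. hedgehog_pt \<alpha> t \<in> U}"
        using Uo \<alpha> by (simp add: hedgehog_open_def)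
      then obtain \<epsilon> where \<epsilon>: "\<epsilon> > 0" "\<And>t'. t' \<in> {0..1} \<Longrightarrow> dist t' t < \<epsilon> \<Longrightarrow> hedgehog_pt \<alpha> t' \<in> U"
        using t CU unfolding openin_euclidean_subtopology_iff by blast
      have "hedgehog_pt \<alpha> t' \<in> ?C" if t': "t' \<in> {0..1}" "dist t' t < \<epsilon>" for t'
      proof (rule step [of \<alpha> t t'])
        fix r assume "r \<in> closed_segment t t'"
        then have "r \<in> {0..1} \<and> dist r t < \<epsilon>"
          using t t' by (auto simp: closed_segment_eq_real_ivl dist_real_def split: if_splits)
        then show "hedgehog_pt \<alpha> r \<in> U" using \<epsilon> by blast
      qed (use t t' \<alpha> in auto)
      then show "\<exists>\<epsilon>>0. \<forall>t'\<in>{0..1}. dist t' t < \<epsilon> \<longrightarrow> t' \<in> {t\<in>{0..1}. hedgehog_pt \<alpha> t \<in> ?C}"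
        using \<epsilon>(1) by blast
    qed auto
    assume c: "hedgehog_pt \<sigma> (1/2) \<in> ?C"
    then obtain W where W: "openin X W" "\<sigma> (1/2) \<in> W"
        "\<forall>\<alpha>\<in>hedgehog_spikes. \<alpha> ` {1/2..1} \<subseteq> W \<longrightarrow> (\<forall>t\<in>{1/2..1}. hedgehog_pt \<alpha> t \<in> U)"
      using CU Uo unfolding hedgehog_open_def by blast
    have "hedgehog_pt \<alpha> t \<in> ?C" if \<alpha>: "\<alpha> \<in> hedgehog_spikes" "\<alpha> ` {1/2..1} \<subseteq> W" "t \<in> {1/2..1}" for \<alpha> t
    proof (rule step [of \<alpha> "1/2" t])
      show "hedgehog_pt \<alpha> (1/2) \<in> ?C" using c pt_stem [of "1/2" \<alpha> \<sigma>] by simp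
      fix r assume "r \<in> closed_segment (1/2) t"
      then have "r \<in> {1/2..1}"
        using \<alpha>(3) by (auto simp: closed_segment_eq_real_ivl split: if_splits)
      then show "hedgehog_pt \<alpha> r \<in> U" using W(3) \<alpha> by blast
    qed (use \<alpha> in auto)
    then show "\<exists>W. openin X W \<and> \<sigma> (1/2) \<in> W \<and>
         (\<forall>\<alpha>\<in>hedgehog_spikes. \<alpha> ` {1/2..1} \<subseteq> W \<longrightarrow> (\<forall>t\<in>{1/2..1}. hedgehog_pt \<alpha> t \<in> ?C))"
      using W by blast
  qed
qed

definition hedgehog_trunc :: "real \<times> (real \<Rightarrow> 'x) \<times> real \<times> real \<Rightarrow> 'x" where
  "hedgehog_trunc w = fst (snd w) (min (fst w) (fst (snd (snd w))))"

lemma trunc_pt: "\<alpha> \<in> hedgehog_spikes \<Longrightarrow> 0 \<le> s \<Longrightarrow> 0 \<le> t \<Longrightarrow> hedgehog_trunc (s, hedgehog_pt \<alpha> t) = \<alpha> (min s t)"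
  by (auto simp: hedgehog_trunc_def hedgehog_pt_def spike_stem)

lemma interval_openI:
  fixes P :: "real \<Rightarrow> bool"
  assumes "open (Collect P)"
  shows "openin (top_of_set {0..1}) {t\<in>{0..1}. P t}"
proof -
  have "{t\<in>{0..1}. P t} = {0..1} \<inter> Collect P" by blast
  then show ?thesis using openin_open_Int [OF assms, of "{0..1}"] by metis
qed

lemma continuous_trunc:
  "continuous_map (prod_topology (top_of_set {0..1::real}) hedgehog) X hedgehog_trunc"
  unfolding continuous_map
proof (intro conjI allI impI)
  show "hedgehog_trunc ` topspace (prod_topology (top_of_set {0..1::real}) hedgehog) \<subseteq> topspace X"
  proof clarsimp
    fix s a b c assume s: "(0::real) \<le> s" "s \<le> 1" and "(a, b, c) \<in> topspace hedgehog"
    then obtain \<alpha> t where q: "(a, b, c) = hedgehog_pt \<alpha> t" "\<alpha> \<in> hedgehog_spikes" "t \<in> {0..1}"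
      by (auto simp: topspace_hedgehog hedgehog_set_def)
    moreover have "min s t \<in> {0..1}" using s q(3) by auto
    ultimately show "hedgehog_trunc (s, a, b, c) \<in> topspace X"
      using s funcset_mem [OF path_image_subset_topspace [OF spike_path]] by (simp add: trunc_pt)
  qed
  fix V assume V: "openin X V"
  let ?T = "{w \<in> topspace (prod_topology (top_of_set {0..1::real}) hedgehog). hedgehog_trunc w \<in> V}"
  show "openin (prod_topology (top_of_set {0..1}) hedgehog) ?T"
    unfolding openin_prod_topology_alt
  proof (intro allI impI)
    fix s q assume "(s, q) \<in> ?T"
    then obtain \<alpha> t where q: "q = hedgehog_pt \<alpha> t" and \<alpha>: "\<alpha> \<in> hedgehog_spikes" and t: "t \<in> {0..1}"
        and s: "s \<in> {0..1}" and sq: "hedgehog_trunc (s, q) \<in> V"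
      by (auto simp: topspace_hedgehog hedgehog_set_def)
    have inV: "\<alpha> (min s t) \<in> V" using sq q \<alpha> s t by (simp add: trunc_pt)
    have suff: "\<exists>U N. openin (top_of_set {0..1}) U \<and> openin hedgehog N \<and> s \<in> U \<and> q \<in> N \<and>
        U \<times> N \<subseteq> ?T"
      if U: "openin (top_of_set {0..1}) U" "s \<in> U" and N: "hedgehog_open N" "q \<in> N"
        and V: "\<And>s' q'. s' \<in> U \<Longrightarrow> q' \<in> N \<Longrightarrow> hedgehog_trunc (s', q') \<in> V" for U N
    proof (intro exI conjI)
      show "U \<times> N \<subseteq> ?T"
        using openin_subset [OF U(1)] N(1) V by (auto simp: hedgehog_open_def topspace_hedgehog)
    qed (use U N in \<open>auto simp: openin_hedgehog\<close>)
    show "\<exists>U N. openin (top_of_set {0..1}) U \<and> openin hedgehog N \<and> s \<in> U \<and> q \<in> N \<and>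
        U \<times> N \<subseteq> ?T"
    proof (cases "t = 1/2")
      case False
      have "continuous_map (top_of_set ({0..1} \<times> {0..1})) (top_of_set {0..1::real})
          (\<lambda>z. min (fst z) (snd z))"
        by (auto simp: continuous_map_in_subtopology intro!: continuous_intros)
      from continuous_map_compose [OF this spike_path [OF \<alpha>, unfolded pathin_def]] V
      have "openin (top_of_set ({0..1} \<times> {0..1}))
          {z \<in> {0..1} \<times> {0..1}. (\<alpha> \<circ> (\<lambda>z. min (fst z) (snd z))) z \<in> V}"
        by (simp add: continuous_map)
      moreover have "(s, t) \<in> {z \<in> {0..1} \<times> {0..1}. (\<alpha> \<circ> (\<lambda>z. min (fst z) (snd z))) z \<in> V}"
        using s t inV by auto
      ultimately have "\<exists>\<epsilon>>0. \<forall>z\<in>{0..1} \<times> {0..1}. dist z (s, t) < \<epsilon> \<longrightarrow>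
          z \<in> {z \<in> {0..1} \<times> {0..1}. (\<alpha> \<circ> (\<lambda>z. min (fst z) (snd z))) z \<in> V}"
        unfolding openin_euclidean_subtopology_iff by blast
      then obtain \<epsilon> where \<epsilon>: "\<epsilon> > 0"
          "\<And>z. z \<in> {0..1} \<times> {0..1} \<Longrightarrow> dist z (s, t) < \<epsilon> \<Longrightarrow> \<alpha> (min (fst z) (snd z)) \<in> V"
        by auto
      define \<delta> where "\<delta> = min (\<epsilon> / 2) \<bar>t - 1/2\<bar>"
      have \<delta>: "\<delta> > 0" "\<delta> \<le> \<epsilon> / 2" "\<delta> \<le> \<bar>t - 1/2\<bar>"
        using \<epsilon>(1) False unfolding \<delta>_def by linarith+
      define N where "N = {hedgehog_pt \<alpha> t' |t'. t' \<in> {0..1} \<and> \<bar>t' - t\<bar> < \<delta>}"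
      have "hedgehog_open N"
        unfolding hedgehog_open_def
      proof (intro conjI ballI impI)
        show "N \<subseteq> hedgehog_set" using \<alpha> unfolding N_def hedgehog_set_def by blast
        fix \<beta> assume \<beta>: "\<beta> \<in> hedgehog_spikes"
        have "{r\<in>{0..1}. hedgehog_pt \<beta> r \<in> N} = {r\<in>{0..1}. \<bar>r - t\<bar> < \<delta> \<and> (t < 1/2 \<or> \<beta> = \<alpha>)}"
          using \<delta>(3) by (auto simp: N_def hedgehog_pt_def split: if_splits)
        moreover have "open {r. \<bar>r - t\<bar> < \<delta> \<and> (t < 1/2 \<or> \<beta> = \<alpha>)}"
          by (intro open_Collect_conj open_Collect_less open_Collect_const continuous_intros)
        ultimately show "openin (top_of_set {0..1}) {r\<in>{0..1}. hedgehog_pt \<beta> r \<in> N}"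
          using interval_openI by simp
      next
        assume "hedgehog_pt \<sigma> (1/2) \<in> N"
        then have False using \<delta>(3) by (auto simp: N_def hedgehog_pt_def)
        then show "\<exists>W. openin X W \<and> \<sigma> (1/2) \<in> W \<and>
         (\<forall>\<alpha>\<in>hedgehog_spikes. \<alpha> ` {1/2..1} \<subseteq> W \<longrightarrow> (\<forall>t\<in>{1/2..1}. hedgehog_pt \<alpha> t \<in> N))" ..
      qed
      moreover have "openin (top_of_set {0..1}) {s'\<in>{0..1}. \<bar>s' - s\<bar> < \<delta>}"
        by (intro interval_openI open_Collect_less continuous_intros)
      moreover have "hedgehog_trunc (s', q') \<in> V" if sN: "s' \<in> {s'\<in>{0..1}. \<bar>s' - s\<bar> < \<delta>}" "q' \<in> N" for s' q'
      proof -
        obtain t' where t': "q' = hedgehog_pt \<alpha> t'" "t' \<in> {0..1}" "\<bar>t' - t\<bar> < \<delta>"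
          using sN(2) by (auto simp: N_def)
        have "dist (s', t') (s, t) \<le> dist s' s + dist t' t"
          unfolding dist_Pair_Pair by (rule sqrt_sum_squares_le_sum) auto
        also have "\<dots> < \<epsilon>" using sN(1) t' \<delta>(2) by (simp add: dist_real_def)
        finally have "\<alpha> (min s' t') \<in> V" using \<epsilon>(2) [of "(s', t')"] sN(1) t' by simp
        then show ?thesis using t' sN(1) \<alpha> by (simp add: trunc_pt)
      qed
      ultimately show ?thesis
        using s t \<delta> q by (intro suff [of "{s'\<in>{0..1}. \<bar>s' - s\<bar> < \<delta>}" N]) (auto simp: N_def)
    next
      case True
      have q\<sigma>: "q = hedgehog_pt \<sigma> (1/2)" using q True pt_stem [of "1/2" \<alpha> \<sigma>] by simp
      have in\<sigma>: "\<sigma> (min s (1/2)) \<in> V" using inV True s spike_stem [OF \<alpha>, of "min s (1/2)"] by simp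
      show ?thesis
      proof (cases "s < 1/2")
        case s2: True
        define m where "m = (s + 1/2) / 2"
        have m: "s < m" "m < 1/2" using s2 by (auto simp: m_def)
        define U where "U = {s'\<in>{0..1}. \<sigma> s' \<in> V} \<inter> {s'\<in>{0..1}. s' < m}"
        have "openin (top_of_set {0..1}) U"
          unfolding U_def
          by (intro openin_Int spike_openin [OF \<sigma>_spike V] interval_openI open_Collect_less
              continuous_intros)
        moreover define N where "N = {hedgehog_pt \<beta> t' |\<beta> t'. \<beta> \<in> hedgehog_spikes \<and> t' \<in> {0..1} \<and> m < t'}"
        have "hedgehog_open N"
          unfolding hedgehog_open_def
        proof (intro conjI ballI impI)
          show "N \<subseteq> hedgehog_set" unfolding N_def hedgehog_set_def by blast
          fix \<beta> assume \<beta>: "\<beta> \<in> hedgehog_spikes"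
          have "{r\<in>{0..1}. hedgehog_pt \<beta> r \<in> N} = {r\<in>{0..1}. m < r}"
            using \<beta> by (auto simp: N_def hedgehog_pt_def)
          moreover have "open {r. m < r}"
            by (intro open_Collect_less continuous_intros)
          ultimately show "openin (top_of_set {0..1}) {r\<in>{0..1}. hedgehog_pt \<beta> r \<in> N}"
            using interval_openI by simp
        next
          have "hedgehog_pt \<beta> r \<in> N" if "\<beta> \<in> hedgehog_spikes" "r \<in> {1/2..1}" for \<beta> r
            using that m unfolding N_def by force
          moreover have "\<sigma> (1/2) \<in> topspace X"
            using path_image_subset_topspace [OF \<sigma>] by (rule funcset_mem) simp
          ultimately show "\<exists>W. openin X W \<and> \<sigma> (1/2) \<in> W \<and>
            (\<forall>\<alpha>\<in>hedgehog_spikes. \<alpha> ` {1/2..1} \<subseteq> W \<longrightarrow> (\<forall>t\<in>{1/2..1}. hedgehog_pt \<alpha> t \<in> N))"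
            by (intro exI [where x = "topspace X"]) auto
        qed
        moreover have "hedgehog_trunc (s', q') \<in> V" if sN: "s' \<in> U" "q' \<in> N" for s' q'
        proof -
          obtain \<beta> t' where t': "q' = hedgehog_pt \<beta> t'" "\<beta> \<in> hedgehog_spikes" "t' \<in> {0..1}" "m < t'"
            using sN(2) by (auto simp: N_def)
          have s': "0 \<le> s'" "s' < m" "\<sigma> s' \<in> V" using sN(1) by (auto simp: U_def)
          then have "hedgehog_trunc (s', q') = \<beta> s'" using t' by (simp add: trunc_pt min_def)
          also have "\<dots> = \<sigma> s'" using spike_stem [OF t'(2), of s'] s' m by simp
          finally show ?thesis using s' by simp
        qed
        moreover have "s \<in> U" using s s2 in\<sigma> m by (simp add: U_def min_def split: if_splits)
        moreover have "q \<in> N" using q\<sigma> \<sigma>_spike m unfolding N_def by force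
        ultimately show ?thesis by (intro suff [of U N])
      next
        case s2: False
        then have "min s (1/2) = 1/2" by simp
        with in\<sigma> have c: "\<sigma> (1/2) \<in> V" by simp
        have "\<exists>\<epsilon>>0. \<forall>r\<in>{0..1}. \<bar>r - 1/2\<bar> < \<epsilon> \<longrightarrow> \<beta> r \<in> V" if \<beta>: "\<beta> \<in> hedgehog_spikes" for \<beta>
        proof -
          have "\<beta> (1/2) \<in> V" using c spike_stem [OF \<beta>, of "1/2"] by simp
          then show ?thesis
            using spike_openin [OF \<beta> V] unfolding openin_euclidean_subtopology_iff
            by (auto simp: dist_real_def)
        qed
        then obtain \<epsilon> where \<epsilon>: "\<And>\<beta>. \<beta> \<in> hedgehog_spikes \<Longrightarrow> \<epsilon> \<beta> > (0::real)"
            "\<And>\<beta> r. \<beta> \<in> hedgehog_spikes \<Longrightarrow> r \<in> {0..1} \<Longrightarrow> \<bar>r - 1/2\<bar> < \<epsilon> \<beta> \<Longrightarrow> \<beta> r \<in> V"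
          by metis
        define U where "U = {s'\<in>{0..1}. 1/2 - \<epsilon> \<sigma> < s'}"
        have "openin (top_of_set {0..1}) U"
          unfolding U_def by (intro interval_openI open_Collect_less continuous_intros)
        moreover define N where "N = {hedgehog_pt \<beta> t' |\<beta> t'. \<beta> \<in> hedgehog_spikes \<and> t' \<in> {0..1} \<and> 1/2 - \<epsilon> \<sigma> < t' \<and>
            (t' < 1/2 + \<epsilon> \<beta> \<or> \<beta> ` {1/2..1} \<subseteq> V)}"
        have "hedgehog_open N"
          unfolding hedgehog_open_def
        proof (intro conjI ballI impI)
          show "N \<subseteq> hedgehog_set" unfolding N_def hedgehog_set_def by blast
          fix \<beta> assume \<beta>: "\<beta> \<in> hedgehog_spikes"
          have "{r\<in>{0..1}. hedgehog_pt \<beta> r \<in> N}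
              = {r\<in>{0..1}. 1/2 - \<epsilon> \<sigma> < r \<and> (r < 1/2 + \<epsilon> \<beta> \<or> \<beta> ` {1/2..1} \<subseteq> V)}"
            (is "?A = ?B")
          proof
            show "?B \<subseteq> ?A" using \<beta> by (auto simp: N_def)
            show "?A \<subseteq> ?B"
            proof
              fix r assume r: "r \<in> ?A"
              then obtain \<gamma> where \<gamma>: "hedgehog_pt \<beta> r = hedgehog_pt \<gamma> r" "1/2 - \<epsilon> \<sigma> < r"
                  "r < 1/2 + \<epsilon> \<gamma> \<or> \<gamma> ` {1/2..1} \<subseteq> V"
                by (auto simp: N_def hedgehog_pt_def)
              show "r \<in> ?B"
              proof (cases "r \<le> 1/2")
                case True then show ?thesis using r \<gamma> \<epsilon>(1) [OF \<beta>] by auto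
              next
                case False then show ?thesis using r \<gamma> by (auto simp: hedgehog_pt_def)
              qed
            qed
          qed
          moreover have "open {r. 1/2 - \<epsilon> \<sigma> < r \<and> (r < 1/2 + \<epsilon> \<beta> \<or> \<beta> ` {1/2..1} \<subseteq> V)}"
            by (intro open_Collect_conj open_Collect_disj open_Collect_less open_Collect_const
                continuous_intros)
          ultimately show "openin (top_of_set {0..1}) {r\<in>{0..1}. hedgehog_pt \<beta> r \<in> N}"
            using interval_openI by simp
        next
          have "hedgehog_pt \<beta> r \<in> N" if "\<beta> \<in> hedgehog_spikes" "\<beta> ` {1/2..1} \<subseteq> V" "r \<in> {1/2..1}" for \<beta> r
          proof -
            have "1/2 - \<epsilon> \<sigma> < r" "r \<in> {0..1}" using that(3) \<epsilon>(1) [OF \<sigma>_spike] by auto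
            then show ?thesis using that unfolding N_def by blast
          qed
          then show "\<exists>W. openin X W \<and> \<sigma> (1/2) \<in> W \<and>
            (\<forall>\<alpha>\<in>hedgehog_spikes. \<alpha> ` {1/2..1} \<subseteq> W \<longrightarrow> (\<forall>t\<in>{1/2..1}. hedgehog_pt \<alpha> t \<in> N))"
            using V c by blast
        qed
        moreover have "hedgehog_trunc (s', q') \<in> V" if sN: "s' \<in> U" "q' \<in> N" for s' q'
        proof -
          obtain \<beta> t' where t': "q' = hedgehog_pt \<beta> t'" "\<beta> \<in> hedgehog_spikes" "t' \<in> {0..1}" "1/2 - \<epsilon> \<sigma> < t'"
              "t' < 1/2 + \<epsilon> \<beta> \<or> \<beta> ` {1/2..1} \<subseteq> V"
            using sN(2) by (auto simp: N_def)
          have s': "s' \<in> {0..1}" "1/2 - \<epsilon> \<sigma> < s'" using sN(1) by (auto simp: U_def)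
          define r where "r = min s' t'"
          have r: "r \<in> {0..1}" "1/2 - \<epsilon> \<sigma> < r" "r \<le> t'" using s' t' by (auto simp: r_def)
          have "\<beta> r \<in> V"
          proof (cases "r \<le> 1/2")
            case True
            then have "\<beta> r = \<sigma> r" using r spike_stem [OF t'(2), of r] by simp
            moreover have "\<sigma> r \<in> V" using r True \<epsilon>(1) [OF \<sigma>_spike] by (intro \<epsilon>(2) [OF \<sigma>_spike]) auto
            ultimately show ?thesis by simp
          next
            case False
            from t'(5) show ?thesis
            proof
              assume "t' < 1/2 + \<epsilon> \<beta>"
              then show ?thesis using r False by (intro \<epsilon>(2) [OF t'(2)]) auto
            next
              assume "\<beta> ` {1/2..1} \<subseteq> V"
              then show ?thesis using r False by auto
            qed
          qed
          then show ?thesis using t' s' by (simp add: trunc_pt r_def)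
        qed
        moreover have "s \<in> U" using s s2 \<epsilon>(1) [OF \<sigma>_spike] by (simp add: U_def)
        moreover have "q \<in> N"
        proof -
          have "1/2 - \<epsilon> \<sigma> < 1/2" "1/2 < 1/2 + \<epsilon> \<sigma>" "(1/2::real) \<in> {0..1}"
            using \<epsilon>(1) [OF \<sigma>_spike] by auto
          then show ?thesis using \<sigma>_spike unfolding q\<sigma> N_def by blast
        qed
        ultimately show ?thesis by (intro suff [of U N])
      qed
    qed
  qed
qed

lemma hedgehog_loops:
  assumes "e \<in> topspace E" "p e = \<sigma> 0" "\<gamma> \<in> loops hedgehog (hedgehog_pt \<sigma> 0)"
  shows "\<exists>\<epsilon>\<in>loops E e. (hedgehog_eval \<circ> \<gamma>, p \<circ> \<epsilon>) \<in> loop_homotopy X (\<sigma> 0)"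
proof (rule trivial_loops [where k = hedgehog_trunc and Y = hedgehog and y = "hedgehog_pt \<sigma> 0" and p = p and e = e])
  fix q assume "q \<in> topspace hedgehog"
  then obtain \<alpha> t where q: "q = hedgehog_pt \<alpha> t" "\<alpha> \<in> hedgehog_spikes" "t \<in> {0..1}"
    by (auto simp: topspace_hedgehog hedgehog_set_def)
  have "min 1 t = t" using q by simp
  then show "hedgehog_trunc (1, q) = hedgehog_eval q" using q by (simp add: trunc_pt ev_pt)
  show "hedgehog_trunc (0, q) = \<sigma> 0" using q spike_stem [OF q(2), of 0] by (simp add: trunc_pt min_def)
next
  show "hedgehog_trunc (s, hedgehog_pt \<sigma> 0) = \<sigma> 0" if "s \<in> {0..1}" for s
    using that \<sigma>_spike by (simp add: trunc_pt)
qed (use assms continuous_trunc in auto)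

end

theorem unique_lifts_from_all_spaces:
  fixes Y :: "'y topology"
  assumes p: "continuous_map E X p" "p e = x" and e: "e \<in> topspace E"
    and ulp: "unique_lifting_property E e X x p"
    and Y: "connected_space Y" "locally_path_connected_space Y" and y: "y \<in> topspace Y"
  shows "unique_lifts_from Y y E e X x p"
  unfolding unique_lifts_from_def
proof (intro allI impI, elim conjE)
  fix f
  assume f: "continuous_map Y X f" "f y = x"
    and "induced_map X x f ` fundamental_group Y y \<subseteq> induced_map X x p ` fundamental_group E e"
  then have incl: "\<exists>\<epsilon>\<in>loops E e. (f \<circ> \<gamma>, p \<circ> \<epsilon>) \<in> loop_homotopy X x" if "\<gamma> \<in> loops Y y" for \<gamma>
    using that induced_map_subset_iff [OF f p] by blast
  note lift = path_lift [OF ulp p e] and uniq = path_lift_unique [OF ulp p e]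
  note same = lifts_same_end [OF ulp p e f incl]
  have pc: "path_connected_space Y" using Y path_connected_eq_connected_space by blast
  have lifted: "\<exists>g. pathin E g \<and> g 0 = e \<and> (\<forall>t\<in>{0..1}. p (g t) = f (\<gamma> t))"
    if "pathin Y \<gamma>" "\<gamma> 0 = y" for \<gamma>
    using lift [of "f \<circ> \<gamma>"] pathin_compose [OF that(1) f(1)] that(2) f(2) by auto
  have "\<exists>\<gamma> g. pathin Y \<gamma> \<and> \<gamma> 0 = y \<and> \<gamma> 1 = z \<and>
      pathin E g \<and> g 0 = e \<and> (\<forall>t\<in>{0..1}. p (g t) = f (\<gamma> t))" if "z \<in> topspace Y" for z
    using pc y that lifted unfolding path_connected_space_def by meson
  then obtain \<gamma> g where \<gamma>g: "\<And>z. z \<in> topspace Y \<Longrightarrow> pathin Y (\<gamma> z) \<and> \<gamma> z 0 = y \<and> \<gamma> z 1 = z \<and>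
      pathin E (g z) \<and> g z 0 = e \<and> (\<forall>t\<in>{0..1}. p (g z t) = f (\<gamma> z t))"
    by metis
  define F where "F = (\<lambda>z\<in>topspace Y. g z 1)"
  have F: "F (\<delta> 1) = d 1" if "pathin Y \<delta>" "\<delta> 0 = y" "pathin E d" "d 0 = e"
      "\<And>t. t \<in> {0..1} \<Longrightarrow> p (d t) = f (\<delta> t)" for \<delta> d
  proof -
    have "\<delta> 1 \<in> topspace Y" using path_finish_in_topspace [OF that(1)] .
    then show ?thesis
      using same [of "\<gamma> (\<delta> 1)" \<delta> "g (\<delta> 1)" d] \<gamma>g that by (simp add: F_def)
  qed
  have pF: "p (F z) = f z" if "z \<in> topspace Y" for z
    using \<gamma>g [OF that] that by (simp add: F_def)
  have Fy: "F y = e"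
    using F [of "\<lambda>_. y" "\<lambda>_. e"] y e p(2) f(2) by simp
  have contF: "continuous_map Y E F"
    unfolding continuous_map
  proof (intro conjI allI impI)
    show "F ` topspace Y \<subseteq> topspace E"
      using \<gamma>g path_finish_in_topspace by (fastforce simp: F_def)
    fix V assume V: "openin E V"
    have "\<exists>C. openin Y C \<and> z \<in> C \<and> C \<subseteq> {z \<in> topspace Y. F z \<in> V}"
      if z: "z \<in> topspace Y" and Fz: "F z \<in> V" for z
    proof -
      define \<sigma> where "\<sigma> = (\<lambda>t. f (path_join (\<gamma> z) (\<lambda>_. z) t))"
      have jz: "pathin Y (path_join (\<gamma> z) (\<lambda>_. z))"
        by (rule pathin_path_join) (use \<gamma>g [OF z] z in auto)
      have \<sigma>: "pathin X \<sigma>"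
        using pathin_compose [OF jz f(1)] by (simp add: \<sigma>_def o_def)
      have \<sigma>0: "\<sigma> 0 = x" and \<sigma>h: "\<sigma> (1/2) = f z"
        using \<gamma>g [OF z] f by (auto simp: \<sigma>_def path_join_def)
      let ?H = "hedgehog X \<sigma>" and ?b = "hedgehog_pt \<sigma> \<sigma> 0"
      have b: "?b \<in> topspace ?H"
        using pt_hset [OF \<sigma> \<sigma>_spike [OF \<sigma>]] topspace_hedgehog [OF \<sigma>] by simp
      have "unique_lifts_from ?H ?b E e X x p"
        using ulp connected_hedgehog [OF \<sigma>] lpc_hedgehog [OF \<sigma>] b
        unfolding unique_lifting_property_def by blast
      moreover have "hedgehog_eval ?b = x" using ev_pt [OF \<sigma> \<sigma>_spike [OF \<sigma>], of 0] \<sigma>0 by simp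
      moreover have "\<exists>\<epsilon>\<in>loops E e. (hedgehog_eval \<circ> \<delta>, p \<circ> \<epsilon>) \<in> loop_homotopy X x"
        if "\<delta> \<in> loops ?H ?b" for \<delta>
        using hedgehog_loops [OF \<sigma> e _ that, of p] p(2) \<sigma>0 by simp
      ultimately have "\<exists>L. continuous_map ?H E L \<and> L ?b = e \<and> (\<forall>q\<in>topspace ?H. p (L q) = hedgehog_eval q)"
        by (rule unique_lifts_fromD(1) [OF _ continuous_ev [OF \<sigma>] _ p b])
      then obtain L where L: "continuous_map ?H E L" "L ?b = e"
          "\<And>q. q \<in> topspace ?H \<Longrightarrow> p (L q) = hedgehog_eval q"
        by blast
      have Lp: "pathin E (\<lambda>t. L (hedgehog_pt \<sigma> \<alpha> t))" "L (hedgehog_pt \<sigma> \<alpha> 0) = e"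
          "\<And>t. t \<in> {0..1} \<Longrightarrow> p (L (hedgehog_pt \<sigma> \<alpha> t)) = \<alpha> t" if \<alpha>: "\<alpha> \<in> hedgehog_spikes X \<sigma>" for \<alpha>
      proof -
        show "pathin E (\<lambda>t. L (hedgehog_pt \<sigma> \<alpha> t))"
          using pathin_compose [OF pathin_pt [OF \<sigma> \<alpha>] L(1)] by (simp add: o_def)
        show "L (hedgehog_pt \<sigma> \<alpha> 0) = e" using L(2) pt_stem [OF \<sigma>, of 0 \<alpha> \<sigma>] by simp
        show "p (L (hedgehog_pt \<sigma> \<alpha> t)) = \<alpha> t" if "t \<in> {0..1}" for t
          using L(3) [of "hedgehog_pt \<sigma> \<alpha> t"] pt_hset [OF \<sigma> \<alpha> that] topspace_hedgehog [OF \<sigma>]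
            ev_pt [OF \<sigma> \<alpha>] that by simp
      qed
      have Lz: "L (hedgehog_pt \<sigma> \<sigma> (1/2)) = F z"
      proof -
        note L\<sigma> = Lp [OF \<sigma>_spike [OF \<sigma>]]
        have 1: "pathin E (\<lambda>t. L (hedgehog_pt \<sigma> \<sigma> (t / 2)))"
          by (rule pathin_reparam [OF L\<sigma>(1)]) (auto intro!: continuous_intros)
        have "F (\<gamma> z 1) = (\<lambda>t. L (hedgehog_pt \<sigma> \<sigma> (t / 2))) 1"
        proof (rule F [of "\<gamma> z" "\<lambda>t. L (hedgehog_pt \<sigma> \<sigma> (t / 2))"])
          show "p (L (hedgehog_pt \<sigma> \<sigma> (t / 2))) = f (\<gamma> z t)" if "t \<in> {0..1}" for t
            using L\<sigma>(3) [of "t / 2"] that by (auto simp: \<sigma>_def path_join_def)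
        qed (use \<gamma>g [OF z] 1 L\<sigma>(2) in auto)
        then show ?thesis using \<gamma>g [OF z] by simp
      qed
      have "openin ?H {q \<in> topspace ?H. L q \<in> V}"
        using L(1) V by (simp add: continuous_map)
      moreover have "hedgehog_pt \<sigma> \<sigma> (1/2) \<in> {q \<in> topspace ?H. L q \<in> V}"
        using Lz Fz pt_hset [OF \<sigma> \<sigma>_spike [OF \<sigma>], of "1/2"] topspace_hedgehog [OF \<sigma>] by simp
      ultimately obtain W where W: "openin X W" "\<sigma> (1/2) \<in> W"
          "\<And>\<alpha> t. \<alpha> \<in> hedgehog_spikes X \<sigma> \<Longrightarrow> \<alpha> ` {1/2..1} \<subseteq> W \<Longrightarrow> t \<in> {1/2..1} \<Longrightarrow> L (hedgehog_pt \<sigma> \<alpha> t) \<in> V"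
        unfolding openin_hedgehog [OF \<sigma>] hedgehog_open_def [OF \<sigma>] by blast
      define D where "D = {w \<in> topspace Y. f w \<in> W}"
      have D: "openin Y D" "z \<in> D" using f(1) W z \<sigma>h by (auto simp: D_def continuous_map)
      define C where "C = Collect (path_component_of (subtopology Y D) z)"
      have "openin Y C"
        using Y(2) D unfolding C_def locally_path_connected_space_eq_open_path_component_of by blast
      moreover have "z \<in> C"
        using D z by (simp add: C_def path_component_of_refl)
      moreover have "w \<in> topspace Y \<and> F w \<in> V" if w: "w \<in> C" for w
      proof -
        obtain \<delta> where \<delta>: "pathin Y \<delta>" "\<And>t. t \<in> {0..1} \<Longrightarrow> \<delta> t \<in> D" "\<delta> 0 = z" "\<delta> 1 = w"
          using w by (auto simp: C_def path_component_of_def pathin_subtopology)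
        define \<alpha> where "\<alpha> = (\<lambda>t. f (path_join (\<gamma> z) \<delta> t))"
        have j: "pathin Y (path_join (\<gamma> z) \<delta>)"
          by (rule pathin_path_join) (use \<gamma>g [OF z] \<delta> in auto)
        have "pathin X \<alpha>"
          using pathin_compose [OF j f(1)] by (simp add: \<alpha>_def o_def)
        then have \<alpha>: "\<alpha> \<in> hedgehog_spikes X \<sigma>"
          unfolding hedgehog_spikes_def [OF \<sigma>] by (auto simp: \<alpha>_def \<sigma>_def path_join_def)
        have "\<alpha> t \<in> W" if "t \<in> {1/2..1}" for t
        proof (cases "t = 1/2")
          case True
          then have "2 * t = 1" by simp
          then show ?thesis using \<gamma>g [OF z] W(2) \<sigma>h by (simp add: \<alpha>_def path_join_def)
        next
          case False
          then show ?thesis using that \<delta>(2) [of "2 * t - 1"] by (simp add: \<alpha>_def path_join_def D_def)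
        qed
        then have "L (hedgehog_pt \<sigma> \<alpha> 1) \<in> V" using W(3) [OF \<alpha>] by force
        moreover have "F (path_join (\<gamma> z) \<delta> 1) = (\<lambda>t. L (hedgehog_pt \<sigma> \<alpha> t)) 1"
        proof (rule F [of "path_join (\<gamma> z) \<delta>" "\<lambda>t. L (hedgehog_pt \<sigma> \<alpha> t)"])
          show "path_join (\<gamma> z) \<delta> 0 = y" using \<gamma>g [OF z] by (simp add: path_join_def)
          show "p (L (hedgehog_pt \<sigma> \<alpha> t)) = f (path_join (\<gamma> z) \<delta> t)" if "t \<in> {0..1}" for t
            using Lp(3) [OF \<alpha> that] by (simp add: \<alpha>_def)
        qed (use j Lp [OF \<alpha>] in auto)
        moreover have "path_join (\<gamma> z) \<delta> 1 = w" using \<delta> by (simp add: path_join_def)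
        moreover have "w \<in> topspace Y" using \<delta> path_finish_in_topspace by blast
        ultimately show ?thesis by simp
      qed
      ultimately show ?thesis by (intro exI [where x = C]) auto
    qed
    then show "openin Y {z \<in> topspace Y. F z \<in> V}"
      by (subst openin_subopen) auto
  qed
  show "\<exists>!g. g \<in> extensional (topspace Y) \<and> continuous_map Y E g \<and> g y = e \<and>
       (\<forall>z\<in>topspace Y. p (g z) = f z)"
  proof (rule ex1I [of _ F])
    show "F \<in> extensional (topspace Y) \<and> continuous_map Y E F \<and> F y = e \<and>
       (\<forall>z\<in>topspace Y. p (F z) = f z)"
      using contF Fy pF by (simp add: F_def)
    fix g' assume g': "g' \<in> extensional (topspace Y) \<and> continuous_map Y E g' \<and> g' y = e \<and>
       (\<forall>z\<in>topspace Y. p (g' z) = f z)"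
    show "g' = F"
    proof (rule extensionalityI [of _ "topspace Y"])
      fix z assume z: "z \<in> topspace Y"
      have tz: "\<gamma> z t \<in> topspace Y" if "t \<in> {0..1}" for t
        using path_image_subset_topspace \<gamma>g [OF z] that by blast
      have "pathin E (g' \<circ> \<gamma> z)"
        using pathin_compose \<gamma>g [OF z] g' by blast
      then have "F (\<gamma> z 1) = (g' \<circ> \<gamma> z) 1"
        using \<gamma>g [OF z] g' tz by (intro F [of "\<gamma> z" "g' \<circ> \<gamma> z"]) simp_all
      then show "g' z = F z" using \<gamma>g [OF z] by simp
    qed (use g' in \<open>auto simp: F_def\<close>)
  qed
qed

end

end

theory Submission
  imports Defs
begin

text \<open>
  Over a group, lifting the paths of a homotopy depends continuously on the paths as soon as it does
  so near the constant path. The quotient of two lifts lifts the quotient of the two paths, so two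
  uniformly close paths starting at the identity differ by a small path starting at the identity, and
  their lifts differ by the lift of that small path.

  That lifts of small paths are small (\<open>small_paths_have_small_lifts\<close>) is where the unique lifting
  property for spaces more complicated than intervals enters: all paths from the base point are
  spikes of one connected, locally path connected space whose evaluation map lifts, and continuity
  of this single lift at the common root controls all small spikes at once.

  A homotopy \<open>h\<close> is brought to the identity by considering \<open>h (z, 0)\<^sup>-\<^sup>1 h (z, t)\<close>. Its tracks are
  paths from the identity; their lifts are jointly continuous in \<open>z\<close> and \<open>t\<close> by compactness of the
  interval (\<open>lifted_tracks_continuous\<close>), and left translation by the prescribed initial lift
  gives the lift of \<open>h\<close>.
\<close>

lemma (in topological_group) continuous_map_group_mult:
  assumes "continuous_map X T f" "continuous_map X T g"
  shows "continuous_map X T (\<lambda>x. f x \<otimes> g x)"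
  using continuous_map_compose [OF continuous_map_pairedI [OF assms] continuous_mult]
  by (simp add: o_def)

lemma (in topological_group) continuous_map_group_inv:
  assumes "continuous_map X T f"
  shows "continuous_map X T (\<lambda>x. inv (f x))"
  using continuous_map_compose [OF assms continuous_inv] by (simp add: o_def)

text \<open>
  The hedgehog whose stem is the constant path at \<open>x\<close> has every path from \<open>x\<close>, run on
  \<open>[1/2, 1]\<close>, as a spike, and its evaluation map lifts. A neighbourhood of the end of the stem
  contains all spikes that stay in some fixed neighbourhood of \<open>x\<close>; the neighbourhood on which the
  lift takes values in \<open>V\<close> thus yields the required \<open>W\<close>, since by unique path lifting a path in \<open>E\<close>
  from \<open>e\<close> is the lift of the spike given by its image in \<open>X\<close>.
\<close>

lemma small_paths_have_small_lifts:
  assumes ulp: "unique_lifting_property E e X x p"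
    and p: "continuous_map E X p" "p e = x" and e: "e \<in> topspace E"
    and V: "openin E V" "e \<in> V"
  obtains W where "openin X W" "x \<in> W"
    "\<And>g. \<lbrakk>pathin E g; g 0 = e; \<And>t. t \<in> {0..1} \<Longrightarrow> p (g t) \<in> W\<rbrakk> \<Longrightarrow> g ` {0..1} \<subseteq> V"
proof -
  have x: "x \<in> topspace X" using p e continuous_map_image_subset_topspace by fastforce
  define \<sigma> :: "real \<Rightarrow> 'b" where "\<sigma> = (\<lambda>_. x)"
  have \<sigma>: "pathin X \<sigma>" using x by (simp add: \<sigma>_def)
  note \<sigma>_spike = \<sigma>_spike [OF \<sigma>] and ev_pt = ev_pt [OF \<sigma>] and pt_hset = pt_hset [OF \<sigma>]
    and topspace_hedgehog = topspace_hedgehog [OF \<sigma>]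
  let ?H = "hedgehog X \<sigma>" and ?pt = "hedgehog_pt \<sigma>"
  let ?b = "?pt \<sigma> 0"
  have b: "?b \<in> topspace ?H"
    using pt_hset [OF \<sigma>_spike] topspace_hedgehog by simp
  have "unique_lifts_from ?H ?b E e X x p"
    using ulp connected_hedgehog [OF \<sigma>] lpc_hedgehog [OF \<sigma>] b
    unfolding unique_lifting_property_def by blast
  moreover have "hedgehog_eval ?b = x" using ev_pt [OF \<sigma>_spike, of 0] by (simp add: \<sigma>_def)
  moreover have "\<exists>\<epsilon>\<in>loops E e. (hedgehog_eval \<circ> \<delta>, p \<circ> \<epsilon>) \<in> loop_homotopy X x"
    if "\<delta> \<in> loops ?H ?b" for \<delta>
    using hedgehog_loops [OF \<sigma> e _ that, of p] p(2) by (simp add: \<sigma>_def)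
  ultimately have "\<exists>L. continuous_map ?H E L \<and> L ?b = e \<and> (\<forall>q\<in>topspace ?H. p (L q) = hedgehog_eval q)"
    by (rule unique_lifts_fromD(1) [OF _ continuous_ev [OF \<sigma>] _ p b])
  then obtain L where L: "continuous_map ?H E L" "L ?b = e"
      "\<And>q. q \<in> topspace ?H \<Longrightarrow> p (L q) = hedgehog_eval q"
    by blast
  have spike: "pathin E (\<lambda>t. L (?pt \<alpha> t))" "p (L (?pt \<alpha> t)) = \<alpha> t"
    if \<alpha>: "\<alpha> \<in> hedgehog_spikes X \<sigma>" and t: "t \<in> {0..1}" for \<alpha> t
  proof -
    show "pathin E (\<lambda>t. L (?pt \<alpha> t))"
      using pathin_compose [OF pathin_pt [OF \<sigma> \<alpha>] L(1)] by (simp add: o_def)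
    show "p (L (?pt \<alpha> t)) = \<alpha> t"
      using L(3) [of "?pt \<alpha> t"] pt_hset [OF \<alpha> t] topspace_hedgehog ev_pt [OF \<alpha>] t by simp
  qed
  have stem: "L (?pt \<sigma> t) = e" if "t \<in> {0..1}" for t
    by (rule path_lift_unique [OF ulp p e, of "\<lambda>t. L (?pt \<sigma> t)" "\<lambda>_. e"])
      (use spike [OF \<sigma>_spike] L(2) e p that in \<open>auto simp: \<sigma>_def\<close>)
  have "openin ?H {q \<in> topspace ?H. L q \<in> V}"
    using L(1) V by (simp add: continuous_map)
  moreover have "?pt \<sigma> (1/2) \<in> {q \<in> topspace ?H. L q \<in> V}"
    using stem V pt_hset [OF \<sigma>_spike, of "1/2"] topspace_hedgehog by simp
  ultimately obtain W where W: "openin X W" "\<sigma> (1/2) \<in> W"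
      "\<And>\<alpha> t. \<alpha> \<in> hedgehog_spikes X \<sigma> \<Longrightarrow> \<alpha> ` {1/2..1} \<subseteq> W \<Longrightarrow> t \<in> {1/2..1} \<Longrightarrow> L (?pt \<alpha> t) \<in> V"
    unfolding openin_hedgehog [OF \<sigma>] hedgehog_open_def [OF \<sigma>] by blast
  show thesis
  proof (rule that [OF W(1)])
    show "x \<in> W" using W(2) by (simp add: \<sigma>_def)
    fix g assume g: "pathin E g" "g 0 = e" "\<And>t. t \<in> {0..1} \<Longrightarrow> p (g t) \<in> W"
    define \<alpha> where "\<alpha> = path_join \<sigma> (p \<circ> g)"
    have "pathin X \<alpha>"
      unfolding \<alpha>_def
      by (rule pathin_path_join [OF \<sigma> pathin_compose [OF g(1) p(1)]]) (simp add: \<sigma>_def g p)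
    then have \<alpha>: "\<alpha> \<in> hedgehog_spikes X \<sigma>"
      unfolding hedgehog_spikes_def [OF \<sigma>] by (auto simp: \<alpha>_def \<sigma>_def path_join_def)
    \<comment> \<open>At \<open>t = 0\<close> the join still takes its value from the stem.\<close>
    have \<alpha>_half: "\<alpha> (1/2 + t/2) = p (g t)" if "t \<in> {0..1}" for t
      using that g(2) p(2) by (cases "t = 0") (auto simp: \<alpha>_def \<sigma>_def path_join_def)
    have "\<alpha> ` {1/2..1} \<subseteq> W"
    proof (rule image_subsetI)
      fix t :: real assume "t \<in> {1/2..1}"
      then show "\<alpha> t \<in> W" using \<alpha>_half [of "2 * t - 1"] g(3) [of "2 * t - 1"]
        by (simp add: field_simps)
    qed
    note in_V = W(3) [OF \<alpha> this]
    have lift_\<alpha>: "L (?pt \<alpha> (1/2 + t/2)) = g t" if "t \<in> {0..1}" for t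
    proof (rule path_lift_unique [OF ulp p e, of "\<lambda>t. L (?pt \<alpha> (1/2 + t/2))" g])
      show "pathin E (\<lambda>t. L (?pt \<alpha> (1/2 + t/2)))"
        by (rule pathin_reparam [OF spike(1) [OF \<alpha>, of 0]]) (auto intro!: continuous_intros)
      show "L (?pt \<alpha> (1/2 + 0/2)) = e"
        using stem [of "1/2"] pt_stem [OF \<sigma>, of "1/2" \<alpha> \<sigma>] by simp
      show "p (L (?pt \<alpha> (1/2 + t/2))) = p (g t)" if "t \<in> {0..1}" for t
        using spike(2) [OF \<alpha>, of "1/2 + t/2"] \<alpha>_half [OF that] that by simp
    qed (use g that in auto)
    show "g ` {0..1} \<subseteq> V"
    proof (rule image_subsetI)
      fix t :: real assume t: "t \<in> {0..1}"
      then show "g t \<in> V" using in_V [of "1/2 + t/2"] lift_\<alpha> [OF t] by simp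
    qed
  qed
qed

text \<open>
  Near \<open>z\<^sub>0\<close>, all values of \<open>k (z\<^sub>0, t)\<^sup>-\<^sup>1 k (z, t)\<close> lie in a given neighbourhood of the identity,
  uniformly in \<open>t\<close> since the interval is compact. The path \<open>K z\<^sub>0 t\<^sup>-\<^sup>1 K z t\<close> lifts it from the
  identity, hence is small as well, so \<open>K z t\<close> is close to \<open>K z\<^sub>0 t\<close>.
\<close>

lemma lifted_tracks_continuous:
  fixes E (structure) and Z :: "'z topology"
  assumes ES: "topological_group E S" and GT: "topological_group G T"
    and hom: "p \<in> hom E G" and p: "continuous_map S T p"
    and ulp: "unique_lifting_property S \<one> T \<one>\<^bsub>G\<^esub> p"
    and k: "continuous_map (prod_topology Z (top_of_set {0..1::real})) T k"
    and K: "\<And>z. z \<in> topspace Z \<Longrightarrow> pathin S (K z)" "\<And>z. z \<in> topspace Z \<Longrightarrow> K z 0 = \<one>"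
    and pK: "\<And>z t. \<lbrakk>z \<in> topspace Z; t \<in> {0..1}\<rbrakk> \<Longrightarrow> p (K z t) = k (z, t)"
  shows "continuous_map (prod_topology Z (top_of_set {0..1})) S (\<lambda>(z, t). K z t)"
proof -
  interpret E: topological_group E S by (rule ES)
  interpret G: topological_group G T by (rule GT)
  interpret group_hom E G p by unfold_locales (rule hom)
  let ?I = "top_of_set {0..1::real}"
  have Kc: "K z t \<in> carrier E" if "z \<in> topspace Z" "t \<in> {0..1}" for z t
    using path_image_subset_topspace [OF K(1) [OF that(1)]] that(2) E.topspace_eq_carrier by auto
  show ?thesis
    unfolding continuous_map
  proof (intro conjI allI impI)
    show "(\<lambda>(z, t). K z t) ` topspace (prod_topology Z ?I) \<subseteq> topspace S"
      using Kc E.topspace_eq_carrier by auto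
    fix V assume V: "openin S V"
    let ?P = "{w \<in> topspace (prod_topology Z ?I). (case w of (z, t) \<Rightarrow> K z t) \<in> V}"
    show "openin (prod_topology Z ?I) ?P"
      unfolding openin_prod_topology_alt
    proof (intro allI impI)
      fix z0 t0 assume "(z0, t0) \<in> ?P"
      then have z0: "z0 \<in> topspace Z" and t0: "t0 \<in> {0..1}" and V0: "K z0 t0 \<in> V" by auto
      have "openin (prod_topology S S) {w \<in> topspace (prod_topology S S). (case w of (a, b) \<Rightarrow> a \<otimes> b) \<in> V}"
        using E.continuous_mult V by (simp add: continuous_map)
      moreover have "(K z0 t0, \<one>) \<in> {w \<in> topspace (prod_topology S S). (case w of (a, b) \<Rightarrow> a \<otimes> b) \<in> V}"
        using Kc [OF z0 t0] V0 by (simp add: E.topspace_eq_carrier)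
      ultimately obtain A B where AB: "openin S A" "openin S B" "K z0 t0 \<in> A" "\<one> \<in> B"
          and "A \<times> B \<subseteq> {w \<in> topspace (prod_topology S S). (case w of (a, b) \<Rightarrow> a \<otimes> b) \<in> V}"
        unfolding openin_prod_topology_alt by meson
      then have mult: "a \<otimes> b \<in> V" if "a \<in> A" "b \<in> B" for a b
        using that by auto
      obtain W where W: "openin T W" "\<one>\<^bsub>G\<^esub> \<in> W"
          "\<And>g. \<lbrakk>pathin S g; g 0 = \<one>; \<And>t. t \<in> {0..1} \<Longrightarrow> p (g t) \<in> W\<rbrakk> \<Longrightarrow> g ` {0..1} \<subseteq> B"
        by (rule small_paths_have_small_lifts [OF ulp p _ _ AB(2,4)])
          (auto simp: E.topspace_eq_carrier)
      define d where "d = (\<lambda>w. inv\<^bsub>G\<^esub> (k (z0, snd w)) \<otimes>\<^bsub>G\<^esub> k w)"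
      have "continuous_map (prod_topology Z ?I) T (\<lambda>w. k (z0, snd w))"
        using continuous_map_compose [OF _ k, of "prod_topology Z ?I" "\<lambda>w. (z0, snd w)"] z0
        by (simp add: o_def continuous_map_pairedI continuous_map_snd)
      then have d: "continuous_map (prod_topology Z ?I) T d"
        unfolding d_def by (intro G.continuous_map_group_mult G.continuous_map_group_inv k)
      define U where "U = {w \<in> topspace (prod_topology Z ?I). d w \<in> W}"
      have "openin (prod_topology Z ?I) U"
        using d W(1) by (simp add: U_def continuous_map)
      moreover have "{z0} \<times> {0..1} \<subseteq> U"
      proof clarify
        fix t :: real assume t: "t \<in> {0..1}"
        have "d (z0, t) = \<one>\<^bsub>G\<^esub>"
          using hom_closed [OF Kc [OF z0 t]] pK [OF z0 t] by (simp add: d_def)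
        then show "(z0, t) \<in> U" using z0 t W(2) by (simp add: U_def)
      qed
      moreover have "compactin ?I {0..1}" by (simp add: compactin_subtopology)
      ultimately obtain N where N: "openin Z N" "z0 \<in> N" "N \<times> {0..1} \<subseteq> U"
        using tube_lemma_right [of Z ?I U "{0..1}" z0] z0 by blast
      define J where "J = {t \<in> topspace ?I. K z0 t \<in> A}"
      have "openin ?I J"
        using K(1) [OF z0] AB(1) unfolding J_def pathin_def continuous_map by blast
      moreover have "t0 \<in> J" using t0 AB(3) by (simp add: J_def)
      moreover have "N \<times> J \<subseteq> ?P"
      proof clarify
        fix z t assume z: "z \<in> N" and t: "t \<in> J"
        have zZ: "z \<in> topspace Z" using z openin_subset [OF N(1)] by blast
        have tI: "t \<in> {0..1}" and tA: "K z0 t \<in> A" using t by (auto simp: J_def)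
        define g where "g = (\<lambda>t. inv (K z0 t) \<otimes> K z t)"
        have "g ` {0..1} \<subseteq> B"
        proof (rule W(3))
          show "pathin S g"
            using K(1) [OF zZ] K(1) [OF z0] unfolding g_def pathin_def
            by (intro E.continuous_map_group_mult E.continuous_map_group_inv)
          show "g 0 = \<one>" by (simp add: g_def K(2) zZ z0)
          fix s :: real assume s: "s \<in> {0..1}"
          have "p (g s) = d (z, s)"
            using Kc [OF z0 s] Kc [OF zZ s] pK [OF z0 s] pK [OF zZ s] by (simp add: g_def d_def)
          moreover have "(z, s) \<in> U" using N(3) z s by blast
          ultimately show "p (g s) \<in> W" by (simp add: U_def)
        qed
        then have "K z0 t \<otimes> g t \<in> V" using tI tA by (intro mult) auto
        moreover have "K z0 t \<otimes> g t = K z t"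
          using Kc [OF z0 tI] Kc [OF zZ tI] by (simp add: g_def flip: E.m_assoc)
        ultimately show "(z, t) \<in> topspace (prod_topology Z ?I) \<and> K z t \<in> V"
          using zZ tI by simp
      qed
      ultimately show "\<exists>N J. openin Z N \<and> openin ?I J \<and> z0 \<in> N \<and> t0 \<in> J \<and> N \<times> J \<subseteq> ?P"
        using N by blast
    qed
  qed
qed

lemma generalized_covering_group_homotopy_lifting:
  fixes E (structure) and Z :: "'z topology"
  assumes GT: "topological_group G T" and cov: "generalized_covering_group E S G T p"
  shows "homotopy_lifting_property Z S T p"
  unfolding homotopy_lifting_property_def
proof (intro allI impI, elim conjE)
  fix h f
  let ?I = "top_of_set {0..1::real}"
  assume h: "continuous_map (prod_topology Z ?I) T h" and f: "continuous_map Z S f"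
    and hf: "\<forall>z\<in>topspace Z. p (f z) = h (z, 0)"
  have ES: "topological_group E S" and hom: "p \<in> hom E G" and p: "continuous_map S T p"
    and ulp: "unique_lifting_property S \<one> T \<one>\<^bsub>G\<^esub> p"
    using cov by (auto simp: generalized_covering_group_def generalized_covering_map_def)
  interpret E: topological_group E S by (rule ES)
  interpret G: topological_group G T by (rule GT)
  interpret group_hom E G p by unfold_locales (rule hom)
  have fc: "f z \<in> carrier E" if "z \<in> topspace Z" for z
    using continuous_map_image_subset_topspace [OF f] that E.topspace_eq_carrier by auto
  have hc: "h (z, t) \<in> carrier G" if "z \<in> topspace Z" "t \<in> {0..1}" for z t
    using continuous_map_image_subset_topspace [OF h] that G.topspace_eq_carrier by auto
  define k where "k = (\<lambda>w. inv\<^bsub>G\<^esub> (h (fst w, 0)) \<otimes>\<^bsub>G\<^esub> h w)"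
  have "continuous_map (prod_topology Z ?I) T (\<lambda>w. h (fst w, 0))"
    using continuous_map_compose [OF _ h, of "prod_topology Z ?I" "\<lambda>w. (fst w, 0)"]
    by (simp add: o_def continuous_map_pairedI continuous_map_fst)
  then have k: "continuous_map (prod_topology Z ?I) T k"
    unfolding k_def by (intro G.continuous_map_group_mult G.continuous_map_group_inv h)
  have "\<exists>g. pathin S g \<and> g 0 = \<one> \<and> (\<forall>t\<in>{0..1}. p (g t) = k (z, t))" if z: "z \<in> topspace Z" for z
  proof (rule path_lift [OF ulp p])
    have "continuous_map ?I (prod_topology Z ?I) (\<lambda>t. (z, t))"
      using z by (intro continuous_map_pairedI) auto
    from continuous_map_compose [OF this k] show "pathin T (\<lambda>t. k (z, t))"
      by (simp add: pathin_def o_def)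
    show "k (z, 0) = \<one>\<^bsub>G\<^esub>" using hc [OF z, of 0] by (simp add: k_def)
  qed (auto simp: E.topspace_eq_carrier)
  then obtain K where K: "\<And>z. z \<in> topspace Z \<Longrightarrow> pathin S (K z)"
      "\<And>z. z \<in> topspace Z \<Longrightarrow> K z 0 = \<one>"
      "\<And>z t. z \<in> topspace Z \<Longrightarrow> t \<in> {0..1} \<Longrightarrow> p (K z t) = k (z, t)"
    by metis
  have Kc: "K z t \<in> carrier E" if "z \<in> topspace Z" "t \<in> {0..1}" for z t
    using path_image_subset_topspace [OF K(1) [OF that(1)]] that(2) E.topspace_eq_carrier by auto
  have "continuous_map (prod_topology Z ?I) S (\<lambda>w. f (fst w))"
    using continuous_map_compose [OF continuous_map_fst f] by (simp add: o_def)
  then have "continuous_map (prod_topology Z ?I) S (\<lambda>w. f (fst w) \<otimes> (case w of (z, t) \<Rightarrow> K z t))"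
    by (intro E.continuous_map_group_mult lifted_tracks_continuous [OF ES GT hom p ulp k K])
  moreover have "p (f z \<otimes> K z t) = h (z, t)" if "z \<in> topspace Z" "t \<in> {0..1}" for z t
  proof -
    have "p (f z \<otimes> K z t) = h (z, 0) \<otimes>\<^bsub>G\<^esub> (inv\<^bsub>G\<^esub> h (z, 0) \<otimes>\<^bsub>G\<^esub> h (z, t))"
      using fc Kc K(3) hf that by (simp add: k_def)
    also have "\<dots> = h (z, t)"
      using hc that by (simp flip: G.m_assoc)
    finally show ?thesis .
  qed
  ultimately show "\<exists>H. continuous_map (prod_topology Z ?I) S H \<and> (\<forall>z\<in>topspace Z. H (z, 0) = f z) \<and>
      (\<forall>z\<in>topspace Z. \<forall>t\<in>{0..1}. p (H (z, t)) = h (z, t))"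
    using fc K(2) by (intro exI [where x = "\<lambda>w. f (fst w) \<otimes> (case w of (z, t) \<Rightarrow> K z t)"]) auto
qed

theorem corollary3p13:
  fixes G :: "('x, 'n) monoid_scheme" and T :: "'x topology"
    and E :: "('e, 'm) monoid_scheme" and S :: "'e topology"
    and p :: "'e \<Rightarrow> 'x"
  assumes "topological_group G T"
    and "connected_space T" and "locally_path_connected_space T"
    and "generalized_covering_group E S G T p"
  shows "fibration TYPE('z) S T p"
  unfolding fibration_def
proof (intro conjI allI)
  show "continuous_map S T p"
    using assms(4) by (simp add: generalized_covering_group_def generalized_covering_map_def)
qed (rule generalized_covering_group_homotopy_lifting [OF assms(1,4)])

end
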